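(* Let $q$ be an odd prime power, and let $\mathbf{B}$ be the $(0,1)$-incidence matrix whose rows are indexed by the secant lines and whose columns are indexed by the external points of the conic $\mathcal{O}$ in $PG(2,q)$. Let $\mathcal{L}$ be the null space of $\mathbf{B}$ over $\mathbb{F}_2$. Then $$\dim_{\mathbb{F}_2}(\mathcal{L})=\begin{cases}\frac{(q-1)^2}{4}+1, & \text{if } q\equiv 1\pmod 4,\\ \frac{(q-1)^2}{4}-1, & \text{if } q\equiv 3\pmod 4.\end{cases}$$
   Context: $PG(2,q)$ is the projective plane over $\mathbb{F}_q$ with homogeneous coordinates; the point $(a_0,a_1,a_2)$ lies on the line $[b_0,b_1,b_2]$ iff $a_0b_0+a_1b_1+a_2b_2=0$. $\mathcal{O}=\{(1,t,t^2)\mid t\in\mathbb{F}_q\}\cup\{(0,0,1)\}$ is the conic $X_1^2-X_0X_2=0$. A line is secant (tangent, passant) if it meets $\mathcal{O}$ in exactly $2$ ($1$, $0$) points. A point is external (absolute, internal) if it lies on exactly $2$ ($1$, $0$) tangent lines. There are $q(q+1)/2$ secant lines and $q(q+1)/2$ external points. The $(\ell,\mathbf{P})$-entry of $\mathbf{B}$ is $1$ if $\mathbf{P}\in\ell$ and $0$ otherwise. *)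

theory Defs
  imports "HOL-Analysis.Cartesian_Space" "HOL-Library.Z2"
begin

text \<open>
  The coordinates \<open>X\<^sub>0, X\<^sub>1, X\<^sub>2\<close> are the components \<open>1, 2, 3\<close> of a vector in \<open>'a ^ 3\<close>. A point of the
  plane is a one-dimensional subspace of \<open>'a ^ 3\<close>, and a line is identified with the set of its
  points.
\<close>

type_synonym 'a pg_point = "('a ^ 3) set"
type_synonym 'a pg_line = "'a pg_point set"

definition pt :: "'a::field ^ 3 \<Rightarrow> 'a pg_point" where
  "pt a = vec.span {a}"

definition line :: "'a::field ^ 3 \<Rightarrow> 'a pg_line" where
  "line b = {pt a |a. a \<noteq> 0 \<and> a $ 1 * b $ 1 + a $ 2 * b $ 2 + a $ 3 * b $ 3 = 0}"

definition pg_points :: "'a::field pg_point set" where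
  "pg_points = {pt a |a. a \<noteq> 0}"

definition pg_lines :: "'a::field pg_line set" where
  "pg_lines = {line b |b. b \<noteq> 0}"

lemma pt_in_line_iff:
  assumes "a \<noteq> 0"
  shows "pt a \<in> line b \<longleftrightarrow> a $ 1 * b $ 1 + a $ 2 * b $ 2 + a $ 3 * b $ 3 = 0"
proof
  assume "pt a \<in> line b"
  then obtain c where c: "pt a = pt c" "c $ 1 * b $ 1 + c $ 2 * b $ 2 + c $ 3 * b $ 3 = 0"
    by (auto simp: line_def)
  have "a \<in> vec.span {c}"
    using c(1) vec.span_base[of a "{a}"] by (simp add: pt_def)
  then obtain k where "a = k *s c"
    by (auto simp: vec.span_singleton)
  then have "a $ 1 * b $ 1 + a $ 2 * b $ 2 + a $ 3 * b $ 3
      = k * (c $ 1 * b $ 1 + c $ 2 * b $ 2 + c $ 3 * b $ 3)"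
    by (simp add: algebra_simps)
  with c(2) show "a $ 1 * b $ 1 + a $ 2 * b $ 2 + a $ 3 * b $ 3 = 0"
    by simp
qed (use assms in \<open>auto simp: line_def\<close>)

definition conic :: "'a::field pg_point set" where
  "conic = range (\<lambda>t. pt (vector [1, t, t\<^sup>2])) \<union> {pt (vector [0, 0, 1])}"

definition secant_lines :: "'a::field pg_line set" where
  "secant_lines = {l \<in> pg_lines. card (l \<inter> conic) = 2}"

definition tangent_lines :: "'a::field pg_line set" where
  "tangent_lines = {l \<in> pg_lines. card (l \<inter> conic) = 1}"

definition external_points :: "'a::field pg_point set" where
  "external_points = {P \<in> pg_points. card {l \<in> tangent_lines. P \<in> l} = 2}"

definition incidence :: "'a::field pg_line \<Rightarrow> 'a pg_point \<Rightarrow> bit" where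
  "incidence l P = (if P \<in> l then 1 else 0)"

text \<open>
  A column vector over \<open>\<bbbF>\<^sub>2\<close> indexed by the external points is represented by a vector
  indexed by all sets \<open>('a ^ 3) set\<close>, a finite type, whose components off \<open>external_points\<close> vanish.
\<close>

definition null_space :: "(bit ^ ('a::{field,finite} pg_point)) set" where
  "null_space = {x. (\<forall>P. P \<notin> external_points \<longrightarrow> x $ P = 0) \<and>
     (\<forall>l \<in> secant_lines. (\<Sum>P \<in> external_points. incidence l P * x $ P) = 0)}"

end

theory Submission imports Defs "HOL-Library.Disjoint_Sets" begin

text \<open>
  Secant lines and external points both correspond to the two-point subsets of the projective line
  over \<open>\<bbbF>\<^sub>q\<close>, a point lying on a line iff the two pairs separate each other harmonically. Translations
  of the affine line act freely on these pairs, with orbits indexed by the squares \<open>n\<close>. Over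
  \<open>\<bbbF>\<^sub>2\<close> a function \<open>y\<close> on pairs is determined by its sums over these orbits together with its sums over
  the families of pairs of given cross-ratio \<open>k\<close> with \<open>{\<infinity>, t}\<close>, for all \<open>t\<close>; the latter, summed
  over \<open>t\<close>, vanish, and otherwise all values occur. In these coordinates the incidence map acts for each
  \<open>t\<close> by the same small matrix, because the parity of the number of roots of a quadratic only depends on
  the vanishing of its discriminant: up to a correction at \<open>k = 0, 1\<close>, it sends the coordinate \<open>k\<close> to
  the coordinate \<open>k / (k - 1)\<close> if \<open>k - 1\<close> is a square and to 0 otherwise. Hence the null space has
  dimension \<open>(q - 1) r + r'\<close>, where \<open>r\<close> counts the squares \<open>k \<noteq> 0, 1\<close> such that \<open>k - 1\<close> is not a
  square and \<open>r'\<close> is the nullity on the translation-invariant functions.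
\<close>

section \<open>Counting over the field with two elements\<close>

text \<open>These simp rules would rewrite sums of bits to exclusive disjunctions.\<close>

declare add_bit_eq_xor [simp del] mult_bit_eq_and [simp del]

lemma UNIV_bit: "(UNIV :: bit set) = {0, 1}"
  by (auto intro: bit.exhaust)

instance bit :: finite
  by standard (simp add: UNIV_bit)

lemma bit_add_self: "x + x = (0::bit)"
  by (cases x) simp_all

lemma bit_add_eq_0_iff: "x + y = 0 \<longleftrightarrow> x = y" for x y :: bit
  by (cases x; cases y) simp_all

lemma of_nat_bit: "of_nat n = (of_bool (odd n) :: bit)"
  by (induction n) auto

lemma bit_sum_diff1:
  fixes f :: "'b \<Rightarrow> bit"
  assumes "finite A" "t \<in> A"
  shows "sum f (A - {t}) = sum f A + f t"
  using sum.remove[OF assms, of f] bit_add_self[of "f t"] by (metis add.commute add.left_commute add.right_neutral)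

text \<open>Coordinates with respect to a basis put the subspace in bijection with the functions
  from the basis to the field. A dimension can thus be read off from a cardinality, which is how the
  null space is treated.\<close>

lemma card_subspace:
  fixes V :: "('f::{field,finite} ^ 'n) set"
  assumes "vec.subspace V"
  shows "card V = CARD('f) ^ vec.dim V"
proof -
  obtain B where B: "B \<subseteq> V" "vec.independent B" "V \<subseteq> vec.span B" "card B = vec.dim V"
    using vec.basis_exists by blast
  have fin: "finite B" by simp
  have span: "V = vec.span B"
    using B assms by (meson subset_antisym vec.span_minimal)
  have "bij_betw (\<lambda>u. \<Sum>v\<in>B. u v *s v) (B \<rightarrow>\<^sub>E UNIV) V"
  proof (rule bij_betw_imageI)
    show "inj_on (\<lambda>u. \<Sum>v\<in>B. u v *s v) (B \<rightarrow>\<^sub>E UNIV)"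
    proof (rule inj_onI)
      fix u w assume uw: "u \<in> B \<rightarrow>\<^sub>E (UNIV :: 'f set)" "w \<in> B \<rightarrow>\<^sub>E (UNIV :: 'f set)"
        and eq: "(\<Sum>v\<in>B. u v *s v) = (\<Sum>v\<in>B. w v *s v)"
      have "(\<Sum>v\<in>B. (u v - w v) *s v) = 0"
        using eq by (simp add: vec.scale_left_diff_distrib sum_subtractf)
      then have "u v - w v = 0" if "v \<in> B" for v
        using vec.independentD[OF B(2) fin subset_refl, of "\<lambda>v. u v - w v"] that by blast
      then show "u = w"
        by (intro PiE_ext[OF uw]) auto
    qed
    show "(\<lambda>u. \<Sum>v\<in>B. u v *s v) ` (B \<rightarrow>\<^sub>E UNIV) = V"
    proof (intro equalityI subsetI)
      fix x assume "x \<in> V"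
      then obtain u where "x = (\<Sum>v\<in>B. u v *s v)"
        using span vec.span_finite[OF fin] by auto
      then have "x = (\<Sum>v\<in>B. restrict u B v *s v)" by simp
      then show "x \<in> (\<lambda>u. \<Sum>v\<in>B. u v *s v) ` (B \<rightarrow>\<^sub>E UNIV)"
        by (intro image_eqI[of _ _ "restrict u B"]) auto
    next
      fix x assume "x \<in> (\<lambda>u. \<Sum>v\<in>B. u v *s v) ` (B \<rightarrow>\<^sub>E UNIV)"
      then show "x \<in> V"
        unfolding span by (auto intro: vec.span_sum vec.span_scale vec.span_base)
    qed
  qed
  then have "card V = card (B \<rightarrow>\<^sub>E (UNIV :: 'f set))"
    by (simp add: bij_betw_same_card)
  then show ?thesis
    using B(4) fin by (simp add: card_PiE)
qed

text \<open>The values on \<open>A\<close> are free and fix all others through their sum. The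
  kernels for the two kinds of coordinates are brought into this shape, with \<open>A\<close> the
  set of free coordinates.\<close>

lemma card_determined_off:
  fixes F :: "'b \<Rightarrow> bit \<Rightarrow> bit"
  assumes "finite A"
  shows "card {v. \<forall>k. k \<notin> A \<longrightarrow> v k = F k (\<Sum>i\<in>A. v i)} = 2 ^ card A"
proof -
  have "bij_betw (\<lambda>v. restrict v A) {v. \<forall>k. k \<notin> A \<longrightarrow> v k = F k (\<Sum>i\<in>A. v i)} (A \<rightarrow>\<^sub>E (UNIV :: bit set))"
  proof (rule bij_betwI[where g = "\<lambda>u k. if k \<in> A then u k else F k (\<Sum>i\<in>A. u i)"], goal_cases)
    case (3 v)
    then have "F k (\<Sum>i\<in>A. restrict v A i) = v k" if "k \<notin> A" for k
      using that by simp
    then show ?case by (auto simp: fun_eq_iff)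
  next
    case (4 u)
    then show ?case by (auto simp: fun_eq_iff PiE_def extensional_def)
  qed auto
  moreover have "card (UNIV :: bit set) = 2"
    by (subst UNIV_bit) simp
  ultimately show ?thesis
    using assms by (simp add: bij_betw_same_card card_PiE)
qed

section \<open>Squares in a finite field of odd order\<close>

definition squares :: "'a::field set" where
  "squares = range (\<lambda>x. x\<^sup>2)"

definition nz_squares :: "'a::field set" where
  "nz_squares = squares - {0}"

lemma squares_eq: "squares = insert 0 nz_squares"
  by (auto simp: squares_def nz_squares_def image_iff intro: exI[of _ 0])

lemma nz_squares_nonzero: "x \<in> nz_squares \<Longrightarrow> x \<noteq> 0"
  by (simp add: nz_squares_def)

lemma zero_notin_nz_squares: "0 \<notin> nz_squares"
  by (simp add: nz_squares_def)

lemma zero_in_squares: "0 \<in> squares"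
  by (simp add: squares_eq)

lemma nz_squaresE:
  assumes "x \<in> nz_squares"
  obtains a where "x = a\<^sup>2" "a \<noteq> 0"
  using assms by (auto simp: nz_squares_def squares_def)

lemma nz_squaresI: "a \<noteq> 0 \<Longrightarrow> a\<^sup>2 \<in> nz_squares"
  by (auto simp: nz_squares_def squares_def)

lemma nz_squares_1: "1 \<in> nz_squares"
  using nz_squaresI[of 1] by simp

lemma nz_squares_mult: "x \<in> nz_squares \<Longrightarrow> y \<in> nz_squares \<Longrightarrow> x * y \<in> nz_squares"
  by (elim nz_squaresE) (auto simp flip: power_mult_distrib intro!: nz_squaresI)

lemma nz_squares_inverse: "x \<in> nz_squares \<Longrightarrow> inverse x \<in> nz_squares"
  by (elim nz_squaresE) (auto simp flip: power_inverse intro!: nz_squaresI)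

lemma nz_squares_divide: "x \<in> nz_squares \<Longrightarrow> y \<in> nz_squares \<Longrightarrow> x / y \<in> nz_squares"
  by (simp add: divide_inverse nz_squares_mult nz_squares_inverse)

lemma nz_squares_mult_iff: "x \<in> nz_squares \<Longrightarrow> x * y \<in> nz_squares \<longleftrightarrow> y \<in> nz_squares"
  using nz_squares_mult[of x y] nz_squares_divide[of "x * y" x] nz_squares_nonzero[of x] by auto

lemma squares_divide_power2: "x \<in> squares \<Longrightarrow> x / a\<^sup>2 \<in> squares"
  by (auto simp: squares_def simp flip: power_divide)

lemma nz_squares_mult_power2: "x \<in> nz_squares \<Longrightarrow> a \<noteq> 0 \<Longrightarrow> x * a\<^sup>2 \<in> nz_squares"
  by (simp add: nz_squares_mult nz_squaresI)

text \<open>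
  In characteristic 2, translation by 1 would pair up the elements.
\<close>

lemma two_nonzero:
  assumes "odd CARD('a::{field,finite})"
  shows "(2::'a) \<noteq> 0"
proof
  assume "(2::'a) = 0"
  then have two: "x + x = 0" for x :: 'a
    by (metis mult_2 mult_zero_left)
  have "(\<Sum>x\<in>(UNIV::'a set). (1::bit)) = 0"
    by (rule sum_involution_eq_0[where h = "\<lambda>x. x + 1"]) (auto simp: add.assoc two bit_add_self)
  then show False using assms by (simp add: of_nat_bit)
qed

lemma sum_card_sqrt: "(\<Sum>d\<in>(UNIV::'a::{field,finite} set). card {x. x\<^sup>2 = d}) = CARD('a)"
  using card_UN_disjoint[of "UNIV::'a set" "\<lambda>d. {x. x\<^sup>2 = d}"]
  by (auto simp: disjoint_iff) (metis (mono_tags, lifting) UNIV_eq_I UN_iff UNIV_I mem_Collect_eq)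

locale odd_field =
  fixes ty :: "'a::{field,finite} itself"
  assumes odd_card: "odd CARD('a)"

context odd_field
begin

lemma two: "(2::'a) \<noteq> 0"
  using two_nonzero odd_card by blast

lemma four: "(4::'a) \<noteq> 0"
proof -
  have "(4::'a) = 2 * 2" by simp
  then show ?thesis using two by (metis mult_eq_0_iff)
qed

lemma neg_eq_iff: "- x = x \<longleftrightarrow> x = (0::'a)"
  using two by (metis add.right_inverse add.inverse_neutral mult_2 mult_eq_0_iff)

text \<open>As 2 is invertible, a nonzero \<open>x\<close> differs from \<open>- x\<close>, and
  their equal bits cancel.\<close>

lemma sum_bit_even_fun:
  fixes g :: "'a \<Rightarrow> bit"
  assumes "\<And>x. g (- x) = g x"
  shows "sum g (UNIV - {0}) = 0"
  by (rule sum_involution_eq_0[where h = uminus]) (auto simp: assms bit_add_self neg_eq_iff)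

lemma sum_bit_sqrt: "(\<Sum>x\<in>UNIV. of_bool (x\<^sup>2 = d)) = (of_bool (d = (0::'a)) :: bit)"
  using sum_bit_even_fun[of "\<lambda>x. of_bool (x\<^sup>2 = d)"]
  by (simp add: bit_sum_diff1 bit_add_eq_0_iff eq_commute[of 0] del: sum_of_bool_eq)

lemma card_sqrt: "card {x. x\<^sup>2 = (d::'a)} = (if d = 0 then 1 else if d \<in> nz_squares then 2 else 0)"
proof -
  consider "d = 0" | a where "d = a\<^sup>2" "a \<noteq> 0" | "d \<notin> squares"
    unfolding squares_def by fastforce
  then show ?thesis
  proof cases
    case (2 a)
    then have "{x. x\<^sup>2 = d} = {a, - a}" by (auto simp: power2_eq_iff)
    then show ?thesis using 2 neg_eq_iff[of a] by (auto simp: nz_squaresI)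
  next
    case 3
    then have "{x. x\<^sup>2 = d} = {}" by (auto simp: squares_def)
    then show ?thesis using 3 by (auto simp: squares_eq)
  qed auto
qed

text \<open>Multiplication by \<open>a\<close> completes the square. Square roots come in pairs
  except for the single root of 0, so the number of roots is odd exactly when the discriminant
  vanishes.\<close>

lemma sum_bit_quadratic:
  fixes a b c :: 'a
  assumes "a \<noteq> 0"
  shows "(\<Sum>x\<in>UNIV. of_bool (a * x\<^sup>2 + 2 * b * x + c = 0)) = (of_bool (b\<^sup>2 = a * c) :: bit)"
proof -
  have "a * x\<^sup>2 + 2 * b * x + c = 0 \<longleftrightarrow> (a * x + b)\<^sup>2 = b\<^sup>2 - a * c" for x
  proof -
    have "a * (a * x\<^sup>2 + 2 * b * x + c) = (a * x + b)\<^sup>2 - (b\<^sup>2 - a * c)"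
      by (simp add: power2_eq_square algebra_simps)
    then show ?thesis using assms by (metis eq_iff_diff_eq_0 mult_eq_0_iff)
  qed
  moreover have "bij (\<lambda>x. a * x + b)"
    using assms by (simp add: bij_def inj_def finite_UNIV_inj_surj)
  ultimately show ?thesis
    using sum.reindex_bij_betw[of "\<lambda>x. a * x + b" UNIV UNIV "\<lambda>x. of_bool (x\<^sup>2 = b\<^sup>2 - a * c) :: bit"]
    by (simp add: sum_bit_sqrt)
qed

text \<open>The field is counted by the fibres of squaring: one root for 0, two for each nonzero
  square.\<close>

lemma card_nz_squares: "2 * card (nz_squares :: 'a set) + 1 = CARD('a)"
proof -
  have "(\<Sum>d\<in>(UNIV::'a set). card {x. x\<^sup>2 = d}) = (\<Sum>d\<in>UNIV. of_bool (d = (0::'a)) + 2 * of_bool (d \<in> nz_squares))"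
    by (rule sum.cong) (auto simp: card_sqrt nz_squares_nonzero)
  also have "\<dots> = 1 + 2 * card (nz_squares :: 'a set)"
    by (simp add: sum.distrib flip: sum_distrib_left)
  finally show ?thesis using sum_card_sqrt[where 'a = 'a] by simp
qed

text \<open>
  Inversion permutes the nonzero squares and fixes only \<open>1\<close> and possibly \<open>-1\<close>.
\<close>

lemma neg1_square_iff: "(- 1 :: 'a) \<in> nz_squares \<longleftrightarrow> even (card (nz_squares :: 'a set))"
proof -
  let ?S = "nz_squares :: 'a set" and ?E = "{1, - 1} \<inter> nz_squares :: 'a set"
  have "(\<Sum>x\<in>?S - ?E. (1::bit)) = 0"
  proof (rule sum_involution_eq_0[where h = inverse])
    fix x assume x: "x \<in> ?S - ?E"
    then have "x \<noteq> 0" "x \<noteq> 1" "x \<noteq> - 1" by (auto simp: nz_squares_nonzero)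
    have "inverse x \<noteq> x"
    proof
      assume "inverse x = x"
      then have "x * x = 1" using \<open>x \<noteq> 0\<close> by (metis right_inverse)
      then show False using \<open>x \<noteq> 1\<close> \<open>x \<noteq> - 1\<close> by (simp add: square_eq_1_iff)
    qed
    then show "inverse x \<noteq> x" .
    show "inverse x \<in> ?S - ?E" using x \<open>x \<noteq> 0\<close>
      by (auto simp: nz_squares_inverse) (metis inverse_inverse_eq inverse_minus_eq inverse_1)+
  qed (auto simp: bit_add_self)
  then have "even (card (?S - ?E))" by (simp add: of_nat_bit split: if_splits)
  moreover have "card ?S = card (?S - ?E) + card ?E"
    by (subst card_Un_disjoint[symmetric]) (auto intro: arg_cong[where f = card])
  moreover have "?E = (if (- 1 :: 'a) \<in> nz_squares then {1, - 1} else {1})"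
    by (auto simp: nz_squares_1)
  ultimately show ?thesis using neg_eq_iff[of 1] by (auto split: if_splits)
qed

text \<open>
  The hyperbola \<open>y\<^sup>2 - z\<^sup>2 = 1\<close> has \<open>q - 1\<close> points; they are counted by the value \<open>k = y\<^sup>2\<close>.
\<close>

lemma card_consecutive_squares:
  "4 * card {k \<in> nz_squares. k - 1 \<in> (nz_squares :: 'a set)} + 2 + card {x. x\<^sup>2 = (- 1 :: 'a)} + 1 = CARD('a)"
proof -
  let ?D = "{(y, z). y\<^sup>2 - z\<^sup>2 = (1::'a)}"
  \<comment> \<open>The factors \<open>y + z\<close> and \<open>y - z\<close> are mutually inverse,
    so the hyperbola is parametrized by \<open>t = y + z\<close> with
    \<open>y - z = 1 / t\<close>.\<close>
  have "bij_betw (\<lambda>(y, z). y + z) ?D (UNIV - {0})"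
  proof (rule bij_betwI[where g = "\<lambda>t. ((t + 1 / t) / 2, (t - 1 / t) / 2)"])
    show "(\<lambda>(y, z). y + z) \<in> ?D \<rightarrow> UNIV - {0}"
      by (auto simp: power2_eq_square square_diff_square_factored)
    show "(\<lambda>t. ((t + 1 / t) / 2, (t - 1 / t) / 2)) \<in> UNIV - {0} \<rightarrow> ?D"
      using two four by (auto simp: power2_eq_square field_simps)
    fix p assume "p \<in> ?D"
    then obtain y z where p: "p = (y, z)" "(y + z) * (y - z) = 1"
      by (cases p) (auto simp: power2_eq_square algebra_simps)
    then have "1 / (y + z) = y - z" by (metis mult_zero_left nonzero_mult_div_cancel_left zero_neq_one)
    then show "((\<lambda>t. ((t + 1 / t) / 2, (t - 1 / t) / 2)) (case p of (y, z) \<Rightarrow> y + z)) = p"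
      using two by (simp add: p flip: mult_2)
  next
    fix t :: 'a assume "t \<in> UNIV - {0}"
    then show "(case ((t + 1 / t) / 2, (t - 1 / t) / 2) of (y, z) \<Rightarrow> y + z) = t"
      using two four by (simp add: field_simps)
  qed
  then have "card ?D = CARD('a) - 1"
    by (simp add: bij_betw_same_card card_Diff_singleton)
  moreover have "card ?D = (\<Sum>k\<in>(UNIV::'a set). card ({y. y\<^sup>2 = k} \<times> {z. z\<^sup>2 = k - 1}))"
  proof -
    have "?D = (\<Union>k\<in>UNIV. {y. y\<^sup>2 = k} \<times> {z. z\<^sup>2 = k - 1})"
      by (auto simp: algebra_simps)
    also have "card \<dots> = (\<Sum>k\<in>(UNIV::'a set). card ({y. y\<^sup>2 = k} \<times> {z. z\<^sup>2 = k - 1}))"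
      by (rule card_UN_disjoint) auto
    finally show ?thesis .
  qed
  \<comment> \<open>Signs of \<open>y\<close> and \<open>z\<close> give four points over a generic
    \<open>k\<close>. For \<open>k = 1\<close> only \<open>z = 0\<close> is possible, leaving two
    points; for \<open>k = 0\<close> only \<open>y = 0\<close>, leaving the square roots of
    -1.\<close>
  moreover have "\<dots> = (\<Sum>k\<in>(UNIV::'a set). 4 * of_bool (k \<in> nz_squares \<and> k - 1 \<in> nz_squares)
      + (if k = 1 then 2 else 0) + (if k = 0 then card {x. x\<^sup>2 = (- 1 :: 'a)} else 0))"
    by (rule sum.cong) (auto simp: card_cartesian_product card_sqrt nz_squares_1 dest: nz_squares_nonzero)
  ultimately have "CARD('a) - 1 = 4 * card {k \<in> nz_squares. k - 1 \<in> (nz_squares :: 'a set)} + 2 + card {x. x\<^sup>2 = (- 1 :: 'a)}"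
    by (simp add: sum.distrib flip: sum_distrib_left)
  moreover have "CARD('a) > 0" by simp
  ultimately show ?thesis by linarith
qed

end

section \<open>The harmonic incidence map\<close>

text \<open>These stand for the functions on two-point subsets of the projective line, extended by 0
  to arguments that encode no subset.\<close>

definition vecs :: "('a::{field,finite} \<Rightarrow> 'a \<Rightarrow> bit) set" where
  "vecs = {y. \<forall>c n. n \<notin> squares \<longrightarrow> y c n = 0}"

text \<open>
  The pair \<open>(c, n)\<close> with \<open>n = a\<^sup>2 \<noteq> 0\<close> encodes the two-point subset \<open>{c + a, c - a}\<close> of the
  projective line, and \<open>(c, 0)\<close> encodes \<open>{\<infinity>, c}\<close>. Then \<open>harmonic_sum y c n\<close> is the sum of \<open>y\<close> over
  all pairs that separate the pair \<open>(c, n)\<close> harmonically.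
\<close>

definition harmonic_sum :: "('a::{field,finite} \<Rightarrow> 'a \<Rightarrow> bit) \<Rightarrow> 'a \<Rightarrow> 'a \<Rightarrow> bit" where
  "harmonic_sum y c n =
    (if n = 0 then \<Sum>m\<in>nz_squares. y c m
     else if n \<in> nz_squares
       then y c 0 + (\<Sum>b\<in>UNIV. \<Sum>m\<in>nz_squares. y b m * of_bool ((b - c)\<^sup>2 = m + n))
     else 0)"

text \<open>A translation moves \<open>c\<close> and keeps \<open>n\<close>, so this is the sum over
  a translation orbit of pairs.\<close>

definition row_sum :: "('a::{field,finite} \<Rightarrow> 'a \<Rightarrow> bit) \<Rightarrow> 'a \<Rightarrow> bit" where
  "row_sum y k = (\<Sum>c\<in>UNIV. y c k)"

text \<open>
  For a square \<open>k\<close>, the points \<open>(c, k (c - t)\<^sup>2)\<close> with \<open>c \<noteq> t\<close> form an orbit of the torus that fixes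
  \<open>\<infinity>\<close> and \<open>t\<close>. For \<open>k \<noteq> 0, 1\<close> they are the pairs of a fixed cross-ratio with \<open>{\<infinity>, t}\<close>; for
  \<open>k = 0\<close> and \<open>k = 1\<close> they are the pairs that contain just \<open>\<infinity>\<close> and just \<open>t\<close>, respectively.
\<close>

definition parabola_sum :: "('a::{field,finite} \<Rightarrow> 'a \<Rightarrow> bit) \<Rightarrow> 'a \<Rightarrow> 'a \<Rightarrow> bit" where
  "parabola_sum y t k = (\<Sum>c\<in>UNIV - {t}. y c (k * (c - t)\<^sup>2))"

text \<open>For \<open>b \<noteq> t\<close> the indicator selects exactly one nonzero square; for
  \<open>b = t\<close> it would require \<open>m = 0\<close>. This turns the indicators left by root
  counts back into parabola sums.\<close>

lemma parabola_sum_nz: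
  assumes "k \<in> nz_squares"
  shows "(\<Sum>b\<in>UNIV. \<Sum>m\<in>nz_squares. y b m * of_bool (m = k * (b - t)\<^sup>2)) = parabola_sum y t k"
proof -
  have "(\<Sum>m\<in>nz_squares. y b m * of_bool (m = k * (b - t)\<^sup>2)) =
      (if b = t then 0 else y b (k * (b - t)\<^sup>2))" for b
  proof (cases "b = t")
    case True
    then show ?thesis by (auto intro!: sum.neutral dest: nz_squares_nonzero)
  next
    case False
    then have "k * (b - t)\<^sup>2 \<in> nz_squares" using assms by (intro nz_squares_mult_power2) auto
    then have "(\<Sum>m\<in>nz_squares. y b m * of_bool (m = k * (b - t)\<^sup>2)) = y b (k * (b - t)\<^sup>2)"
      by (subst sum.remove[of _ "k * (b - t)\<^sup>2"]) (auto intro!: sum.neutral)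
    then show ?thesis using False by simp
  qed
  then have "(\<Sum>b\<in>UNIV. \<Sum>m\<in>nz_squares. y b m * of_bool (m = k * (b - t)\<^sup>2)) =
      (\<Sum>b\<in>UNIV. if b = t then 0 else y b (k * (b - t)\<^sup>2))"
    by simp
  also have "\<dots> = parabola_sum y t k"
    unfolding parabola_sum_def by (rule sum.mono_neutral_cong_right) auto
  finally show ?thesis .
qed

text \<open>For fixed \<open>b \<noteq> t\<close>, multiplication by the square of
  \<open>b - t\<close> permutes the nonzero squares.\<close>

lemma sum_parabola_sum:
  "(\<Sum>k\<in>nz_squares. parabola_sum y t k) = (\<Sum>b\<in>UNIV - {t}. \<Sum>m\<in>nz_squares. y b m)"
proof -
  have "(\<Sum>k\<in>nz_squares. y b (k * (b - t)\<^sup>2)) = (\<Sum>m\<in>nz_squares. y b m)" if "b \<noteq> t" for b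
    by (rule sum.reindex_bij_witness[where i = "\<lambda>m. m / (b - t)\<^sup>2" and j = "\<lambda>k. k * (b - t)\<^sup>2"])
       (use that in \<open>auto simp: nz_squares_mult nz_squares_divide nz_squaresI\<close>)
  then show ?thesis
    unfolding parabola_sum_def by (subst sum.swap) (auto intro: sum.cong)
qed

text \<open>Interchanging the sums isolates the coefficient of each \<open>y b m\<close>: the parity
  of the number of pairs on the parabola that are harmonic to \<open>(b, m)\<close>.\<close>

lemma parabola_sum_harmonic_sum_nz:
  fixes y :: "'a::{field,finite} \<Rightarrow> 'a \<Rightarrow> bit"
  assumes "k \<in> nz_squares"
  shows "parabola_sum (harmonic_sum y) t k = parabola_sum y t 0 +
    (\<Sum>b\<in>UNIV. \<Sum>m\<in>nz_squares. y b m * (\<Sum>c\<in>UNIV - {t}. of_bool ((b - c)\<^sup>2 = m + k * (c - t)\<^sup>2)))"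
proof -
  have "parabola_sum (harmonic_sum y) t k =
      (\<Sum>c\<in>UNIV - {t}. y c 0 + (\<Sum>b\<in>UNIV. \<Sum>m\<in>nz_squares. y b m * of_bool ((b - c)\<^sup>2 = m + k * (c - t)\<^sup>2)))"
    unfolding parabola_sum_def
  proof (rule sum.cong)
    fix c assume "c \<in> UNIV - {t}"
    then have "k * (c - t)\<^sup>2 \<in> nz_squares" using assms by (intro nz_squares_mult_power2) auto
    moreover from this have "k * (c - t)\<^sup>2 \<noteq> 0" by (rule nz_squares_nonzero)
    ultimately show "harmonic_sum y c (k * (c - t)\<^sup>2) =
        y c 0 + (\<Sum>b\<in>UNIV. \<Sum>m\<in>nz_squares. y b m * of_bool ((b - c)\<^sup>2 = m + k * (c - t)\<^sup>2))"
      by (simp only: harmonic_sum_def if_True if_False)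
  qed simp
  also have "\<dots> = parabola_sum y t 0 +
      (\<Sum>c\<in>UNIV - {t}. \<Sum>b\<in>UNIV. \<Sum>m\<in>nz_squares. y b m * of_bool ((b - c)\<^sup>2 = m + k * (c - t)\<^sup>2))"
    by (simp only: sum.distrib) (simp add: parabola_sum_def)
  also have "(\<Sum>c\<in>UNIV - {t}. \<Sum>b\<in>UNIV. \<Sum>m\<in>nz_squares. y b m * of_bool ((b - c)\<^sup>2 = m + k * (c - t)\<^sup>2)) =
      (\<Sum>b\<in>UNIV. \<Sum>c\<in>UNIV - {t}. \<Sum>m\<in>nz_squares. y b m * of_bool ((b - c)\<^sup>2 = m + k * (c - t)\<^sup>2))"
    by (rule sum.swap)
  also have "\<dots> = (\<Sum>b\<in>UNIV. \<Sum>m\<in>nz_squares. \<Sum>c\<in>UNIV - {t}. y b m * of_bool ((b - c)\<^sup>2 = m + k * (c - t)\<^sup>2))"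
    by (intro sum.cong[OF refl] sum.swap)
  also have "\<dots> = (\<Sum>b\<in>UNIV. \<Sum>m\<in>nz_squares. y b m * (\<Sum>c\<in>UNIV - {t}. of_bool ((b - c)\<^sup>2 = m + k * (c - t)\<^sup>2)))"
    by (simp only: sum_distrib_left)
  finally show ?thesis .
qed

lemma parabola_sum_harmonic_sum_0:
  fixes y :: "'a::{field,finite} \<Rightarrow> 'a \<Rightarrow> bit"
  shows "parabola_sum (harmonic_sum y) t 0 = (\<Sum>k\<in>nz_squares. parabola_sum y t k)"
  unfolding sum_parabola_sum by (simp add: parabola_sum_def harmonic_sum_def)

lemma row_sum_harmonic_sum_0:
  fixes y :: "'a::{field,finite} \<Rightarrow> 'a \<Rightarrow> bit"
  shows "row_sum (harmonic_sum y) 0 = (\<Sum>k\<in>nz_squares. row_sum y k)"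
  by (simp add: row_sum_def harmonic_sum_def) (rule sum.swap)

section \<open>Inversion of the parabola sums and the harmonic map in these coordinates\<close>

context odd_field
begin

lemma sum_shift_even_fun:
  fixes g :: "'a \<Rightarrow> bit"
  assumes "\<And>x. g (- x) = g x"
  shows "(\<Sum>t\<in>UNIV - {c}. g (c - t)) = 0"
proof -
  have "(\<Sum>t\<in>UNIV - {c}. g (c - t)) = sum g (UNIV - {0})"
    by (rule sum.reindex_bij_witness[where i = "\<lambda>t. c - t" and j = "\<lambda>t. c - t"]) auto
  then show ?thesis using sum_bit_even_fun[of g] assms by simp
qed

text \<open>For fixed \<open>c\<close>, the values \<open>t\<close> and \<open>2 * c - t\<close>
  give the same term and cancel. This is the one linear relation between the parabola sums for
  different \<open>t\<close>.\<close>

lemma sum_parabola_sum_shift: "(\<Sum>t\<in>UNIV. parabola_sum y t (k::'a)) = 0"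
proof -
  have "(\<Sum>t\<in>UNIV. parabola_sum y t k) = (\<Sum>t\<in>UNIV. \<Sum>c\<in>{c\<in>UNIV. c \<noteq> t}. y c (k * (c - t)\<^sup>2))"
    unfolding parabola_sum_def by (intro sum.cong) auto
  also have "\<dots> = (\<Sum>c\<in>UNIV. \<Sum>t\<in>{t\<in>UNIV. c \<noteq> t}. y c (k * (c - t)\<^sup>2))"
    by (rule sum.swap_restrict) auto
  also have "\<dots> = (\<Sum>c\<in>UNIV. \<Sum>t\<in>UNIV - {c}. y c (k * (c - t)\<^sup>2))"
    by (intro sum.cong) auto
  also have "\<dots> = 0"
    using sum_shift_even_fun[of "\<lambda>x. y c (k * x\<^sup>2)" c for c] by (intro sum.neutral) simp
  finally show ?thesis .
qed

text \<open>
  For \<open>b \<noteq> c\<close> the ratio \<open>(b - t) / (c - t)\<close> runs through everything but \<open>0\<close> and \<open>1\<close>, so that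
  only the missing value \<open>1\<close> survives the cancellation of opposite ratios modulo 2.
\<close>

lemma parabola_inversion:
  fixes y :: "'a \<Rightarrow> 'a \<Rightarrow> bit"
  shows "y c n = row_sum y n + (\<Sum>t\<in>UNIV - {c}. parabola_sum y t (n / (c - t)\<^sup>2))"
proof -
  define g where "g b t = y b (n * ((b - t) / (c - t))\<^sup>2)" for b t
  have inner: "(\<Sum>t\<in>{t\<in>UNIV - {c}. b \<noteq> t}. g b t) = (if b = c then 0 else y b n)" for b
  proof (cases "b = c")
    case True
    \<comment> \<open>Here every ratio is 1, which gives \<open>q - 1\<close> equal terms, an even
      number.\<close>
    have "(\<Sum>t\<in>{t\<in>UNIV - {c}. b \<noteq> t}. g b t) = (\<Sum>t\<in>UNIV - {c}. y c n)"
      by (rule sum.cong) (auto simp: True g_def)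
    also have "\<dots> = 0"
      using odd_card by (simp add: of_nat_bit card_Diff_singleton)
    finally show ?thesis using True by simp
  next
    case False
    \<comment> \<open>Solving \<open>u = (b - t) / (c - t)\<close> for \<open>t\<close> gives
      \<open>t = (b - u * c) / (1 - u)\<close>; these facts make the two maps mutually
      inverse.\<close>
    have right: "(b - (b - u * c) / (1 - u)) / (c - (b - u * c) / (1 - u)) = u"
      and ne: "(b - u * c) / (1 - u) \<noteq> c" "u \<noteq> 0 \<Longrightarrow> b \<noteq> (b - u * c) / (1 - u)" if "u \<noteq> 1" for u
    proof -
      have c: "c - (b - u * c) / (1 - u) = (c - b) / (1 - u)"
        and b: "b - (b - u * c) / (1 - u) = u * ((c - b) / (1 - u))"
        using that by (simp_all add: diff_divide_eq_iff diff_eq_eq algebra_simps)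
      have 0: "(c - b) / (1 - u) \<noteq> 0" using that False by simp
      then show "(b - (b - u * c) / (1 - u)) / (c - (b - u * c) / (1 - u)) = u"
        unfolding b c by simp
      show "(b - u * c) / (1 - u) \<noteq> c" using c 0 by auto
      show "b \<noteq> (b - u * c) / (1 - u)" if "u \<noteq> 0" using b 0 that by auto
    qed
    have left: "(b - (b - t) / (c - t) * c) / (1 - (b - t) / (c - t)) = t" if "t \<noteq> c" for t
    proof -
      have "1 - (b - t) / (c - t) = (c - b) / (c - t)"
        and "b - (b - t) / (c - t) * c = t * ((c - b) / (c - t))"
        using that by (simp_all add: diff_divide_eq_iff divide_diff_eq_iff algebra_simps)
      then show ?thesis using that False by simp
    qed
    have "(\<Sum>t\<in>{t\<in>UNIV - {c}. b \<noteq> t}. g b t) = (\<Sum>u\<in>UNIV - {0} - {1}. y b (n * u\<^sup>2))"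
      by (rule sum.reindex_bij_witness[where i = "\<lambda>u. (b - u * c) / (1 - u)" and j = "\<lambda>t. (b - t) / (c - t)"])
         (use False left right ne in \<open>auto simp: g_def\<close>)
    also have "\<dots> = (\<Sum>u\<in>UNIV - {0}. y b (n * u\<^sup>2)) + y b n"
      by (subst bit_sum_diff1) auto
    also have "\<dots> = y b n"
      using sum_bit_even_fun[of "\<lambda>u. y b (n * u\<^sup>2)"] by simp
    finally show ?thesis using False by simp
  qed
  have "(\<Sum>t\<in>UNIV - {c}. parabola_sum y t (n / (c - t)\<^sup>2)) = (\<Sum>t\<in>UNIV - {c}. \<Sum>b\<in>{b\<in>UNIV. b \<noteq> t}. g b t)"
    unfolding parabola_sum_def g_def by (intro sum.cong) (auto simp: power_divide)
  also have "\<dots> = (\<Sum>b\<in>UNIV. \<Sum>t\<in>{t\<in>UNIV - {c}. b \<noteq> t}. g b t)"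
    by (rule sum.swap_restrict) auto
  also have "\<dots> = (\<Sum>b\<in>UNIV. if b = c then 0 else y b n)"
    by (simp only: inner)
  also have "\<dots> = (\<Sum>b\<in>UNIV - {c}. y b n)"
    by (rule sum.mono_neutral_cong_right) auto
  also have "\<dots> = row_sum y n + y c n"
    unfolding row_sum_def by (rule bit_sum_diff1) auto
  finally show ?thesis by (simp add: bit_add_self flip: add.assoc)
qed

text \<open>In \<open>c\<close> the condition is a quadratic equation with leading coefficient
  \<open>1 - k\<close>. The first indicator expresses that its discriminant vanishes, the second
  corrects for the excluded value \<open>c = t\<close>.\<close>

lemma parabola_count:
  fixes b t k m :: 'a
  assumes "k \<noteq> 1"
  shows "(\<Sum>c\<in>UNIV - {t}. of_bool ((b - c)\<^sup>2 = m + k * (c - t)\<^sup>2)) =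
    (of_bool (m * (k - 1) = k * (b - t)\<^sup>2) + of_bool (m = (b - t)\<^sup>2) :: bit)"
proof -
  have "(b - c)\<^sup>2 = m + k * (c - t)\<^sup>2 \<longleftrightarrow> (1 - k) * c\<^sup>2 + 2 * (k * t - b) * c + (b\<^sup>2 - m - k * t\<^sup>2) = 0" for c
  proof -
    have "(b - c)\<^sup>2 - (m + k * (c - t)\<^sup>2) = (1 - k) * c\<^sup>2 + 2 * (k * t - b) * c + (b\<^sup>2 - m - k * t\<^sup>2)"
      by (simp add: power2_eq_square algebra_simps)
    then show ?thesis by (metis eq_iff_diff_eq_0)
  qed
  moreover have "(k * t - b)\<^sup>2 = (1 - k) * (b\<^sup>2 - m - k * t\<^sup>2) \<longleftrightarrow> m * (k - 1) = k * (b - t)\<^sup>2"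
  proof -
    have "(k * t - b)\<^sup>2 - (1 - k) * (b\<^sup>2 - m - k * t\<^sup>2) = k * (b - t)\<^sup>2 - m * (k - 1)"
      by (simp add: power2_eq_square algebra_simps)
    then show ?thesis by (metis eq_iff_diff_eq_0)
  qed
  moreover have "(1 - k) * t\<^sup>2 + 2 * (k * t - b) * t + (b\<^sup>2 - m - k * t\<^sup>2) = 0 \<longleftrightarrow> m = (b - t)\<^sup>2"
    using calculation(1)[of t] by auto
  moreover have "1 - k \<noteq> 0" using assms by simp
  ultimately show ?thesis
    using sum_bit_quadratic[OF \<open>1 - k \<noteq> 0\<close>, of "k * t - b" "b\<^sup>2 - m - k * t\<^sup>2"]
    by (simp only: bit_sum_diff1 finite UNIV_I)
qed

text \<open>For \<open>k = 1\<close> the equation becomes linear: one solution if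
  \<open>b \<noteq> t\<close>, none if \<open>b = t\<close> because \<open>m \<noteq> 0\<close>. The
  last indicator again accounts for the excluded \<open>c = t\<close>.\<close>

lemma parabola_count_1:
  fixes b t m :: 'a
  assumes "m \<noteq> 0"
  shows "(\<Sum>c\<in>UNIV - {t}. of_bool ((b - c)\<^sup>2 = m + (c - t)\<^sup>2)) =
    (of_bool (b \<noteq> t) + of_bool (m = (b - t)\<^sup>2) :: bit)"
proof -
  have eq: "(b - c)\<^sup>2 = m + (c - t)\<^sup>2 \<longleftrightarrow> 2 * (b - t) * c = b\<^sup>2 - m - t\<^sup>2" for c
  proof -
    have "(b - c)\<^sup>2 - (m + (c - t)\<^sup>2) = (b\<^sup>2 - m - t\<^sup>2) - 2 * (b - t) * c"
      by (simp add: power2_eq_square algebra_simps)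
    then show ?thesis by (metis eq_iff_diff_eq_0)
  qed
  have "(\<Sum>c\<in>UNIV. of_bool ((b - c)\<^sup>2 = m + (c - t)\<^sup>2)) = (of_bool (b \<noteq> t) :: bit)"
  proof (cases "b = t")
    case True
    then show ?thesis using assms by (intro trans[OF sum.neutral]) (auto simp: power2_commute[of t])
  next
    case False
    then have "(b - c)\<^sup>2 = m + (c - t)\<^sup>2 \<longleftrightarrow> c = (b\<^sup>2 - m - t\<^sup>2) / (2 * (b - t))" for c
      using two unfolding eq by (simp add: nonzero_eq_divide_eq mult.commute)
    then show ?thesis using False by simp
  qed
  moreover have "(b - t)\<^sup>2 = m + (t - t)\<^sup>2 \<longleftrightarrow> m = (b - t)\<^sup>2"
    by auto
  ultimately show ?thesis
    by (simp add: bit_sum_diff1 del: sum_of_bool_eq)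
qed

text \<open>Of the two indicators in \<open>parabola_count\<close>, one describes the parabola with
  parameter \<open>k / (k - 1)\<close> and the other that with parameter 1. The former contains
  codes of pairs only if \<open>k - 1\<close> is a square.\<close>

lemma parabola_sum_harmonic_sum:
  fixes y :: "'a \<Rightarrow> 'a \<Rightarrow> bit"
  assumes "k \<in> nz_squares" "k \<noteq> 1"
  shows "parabola_sum (harmonic_sum y) t k = parabola_sum y t 0 + parabola_sum y t 1 +
    (if k - 1 \<in> nz_squares then parabola_sum y t (k / (k - 1)) else 0)"
proof -
  have k1: "k - 1 \<noteq> 0" using assms by simp
  have iff: "m * (k - 1) = k * (b - t)\<^sup>2 \<longleftrightarrow> m = k / (k - 1) * (b - t)\<^sup>2" for m b
    using k1 by (simp add: field_simps)
  have "(\<Sum>b\<in>UNIV. \<Sum>m\<in>nz_squares. y b m * of_bool (m = k / (k - 1) * (b - t)\<^sup>2)) =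
      (if k - 1 \<in> nz_squares then parabola_sum y t (k / (k - 1)) else 0)"
  proof (cases "k - 1 \<in> nz_squares")
    case True
    then show ?thesis using assms by (simp only: parabola_sum_nz[OF nz_squares_divide] if_True)
  next
    case False
    \<comment> \<open>A nonzero square \<open>m\<close> of this form would make \<open>k - 1\<close>
      a quotient of nonzero squares.\<close>
    have "m \<noteq> k / (k - 1) * (b - t)\<^sup>2" if m: "m \<in> nz_squares" for m b
    proof
      assume *: "m = k / (k - 1) * (b - t)\<^sup>2"
      then have "b \<noteq> t" using nz_squares_nonzero[OF m] by auto
      then have "k * (b - t)\<^sup>2 / m \<in> nz_squares"
        using m assms by (intro nz_squares_divide nz_squares_mult_power2) auto
      moreover have "k * (b - t)\<^sup>2 / m = k - 1"
        using nz_squares_nonzero[OF m] iff[of m b] * by (simp add: nonzero_divide_eq_eq mult.commute)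
      ultimately show False using False by simp
    qed
    then show ?thesis using False by (auto intro!: sum.neutral)
  qed
  moreover have "(\<Sum>b\<in>UNIV. \<Sum>m\<in>nz_squares. y b m * of_bool (m = (b - t)\<^sup>2)) = parabola_sum y t 1"
    using parabola_sum_nz[OF nz_squares_1, of y t] by simp
  ultimately show ?thesis
    unfolding parabola_sum_harmonic_sum_nz[OF assms(1)] parabola_count[OF assms(2)] iff
    by (simp only: distrib_left sum.distrib ac_simps)
qed

text \<open>The indicator of \<open>b \<noteq> t\<close> from the linear case collects all pairs
  \<open>(b, m)\<close> with \<open>b \<noteq> t\<close> and \<open>m\<close> a nonzero square,
  hence the sum of all parabola sums with nonzero \<open>k\<close>.\<close>

lemma parabola_sum_harmonic_sum_1:
  fixes y :: "'a \<Rightarrow> 'a \<Rightarrow> bit"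
  shows "parabola_sum (harmonic_sum y) t 1 = parabola_sum y t 0 + parabola_sum y t 1 +
    (\<Sum>k\<in>nz_squares. parabola_sum y t k)"
proof -
  have "(\<Sum>b\<in>UNIV. \<Sum>m\<in>nz_squares. y b m * of_bool (b \<noteq> t)) = (\<Sum>b\<in>UNIV - {t}. \<Sum>m\<in>nz_squares. y b m)"
    by (rule sum.mono_neutral_cong_right) auto
  moreover have "(\<Sum>b\<in>UNIV. \<Sum>m\<in>nz_squares. y b m * of_bool (m = (b - t)\<^sup>2)) = parabola_sum y t 1"
    using parabola_sum_nz[OF nz_squares_1, of y t] by simp
  moreover have "(\<Sum>b\<in>UNIV. \<Sum>m\<in>nz_squares. y b m * (\<Sum>c\<in>UNIV - {t}. of_bool ((b - c)\<^sup>2 = m + 1 * (c - t)\<^sup>2))) =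
      (\<Sum>b\<in>UNIV. \<Sum>m\<in>nz_squares. y b m * of_bool (b \<noteq> t) + y b m * of_bool (m = (b - t)\<^sup>2))"
    by (intro sum.cong refl, subst mult_1, subst parabola_count_1) (auto simp: distrib_left dest: nz_squares_nonzero)
  ultimately show ?thesis
    unfolding parabola_sum_harmonic_sum_nz[OF nz_squares_1] sum_parabola_sum
    by (simp only: sum.distrib ac_simps)
qed

text \<open>For given \<open>b\<close> and \<open>m\<close>, the number of \<open>c\<close> with
  \<open>(b - c)\<^sup>2 = m + k\<close> is odd only when \<open>m = - k\<close>.\<close>

lemma row_sum_harmonic_sum_nz:
  fixes y :: "'a \<Rightarrow> 'a \<Rightarrow> bit"
  assumes "k \<in> nz_squares"
  shows "row_sum (harmonic_sum y) k = row_sum y 0 + (if - k \<in> nz_squares then row_sum y (- k) else 0)"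
proof -
  have cnt: "(\<Sum>c\<in>UNIV. of_bool ((b - c)\<^sup>2 = m + k)) = (of_bool (m = - k) :: bit)" for b m
  proof -
    have "(\<Sum>c\<in>UNIV. of_bool ((b - c)\<^sup>2 = m + k)) = (\<Sum>x\<in>UNIV. of_bool (x\<^sup>2 = m + k) :: bit)"
      by (rule sum.reindex_bij_witness[where i = "\<lambda>x. b - x" and j = "\<lambda>x. b - x"]) auto
    then show ?thesis using sum_bit_sqrt[of "m + k"] by (simp only: eq_neg_iff_add_eq_0)
  qed
  have "row_sum (harmonic_sum y) k =
      row_sum y 0 + (\<Sum>c\<in>UNIV. \<Sum>b\<in>UNIV. \<Sum>m\<in>nz_squares. y b m * of_bool ((b - c)\<^sup>2 = m + k))"
    using assms nz_squares_nonzero[OF assms] by (simp only: row_sum_def harmonic_sum_def if_True if_False sum.distrib)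
  also have "(\<Sum>c\<in>UNIV. \<Sum>b\<in>UNIV. \<Sum>m\<in>nz_squares. y b m * of_bool ((b - c)\<^sup>2 = m + k)) =
      (\<Sum>b\<in>UNIV. \<Sum>c\<in>UNIV. \<Sum>m\<in>nz_squares. y b m * of_bool ((b - c)\<^sup>2 = m + k))"
    by (rule sum.swap)
  also have "\<dots> = (\<Sum>b\<in>UNIV. \<Sum>m\<in>nz_squares. \<Sum>c\<in>UNIV. y b m * of_bool ((b - c)\<^sup>2 = m + k))"
    by (intro sum.cong[OF refl] sum.swap)
  also have "\<dots> = (\<Sum>b\<in>UNIV. \<Sum>m\<in>nz_squares. y b m * of_bool (m = - k))"
    by (simp only: cnt flip: sum_distrib_left)
  also have "\<dots> = (\<Sum>b\<in>UNIV. if - k \<in> nz_squares then y b (- k) else 0)"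
  proof (rule sum.cong)
    fix b
    have "(\<Sum>m\<in>nz_squares. y b m * of_bool (m = - k)) = (\<Sum>m\<in>nz_squares. if m = - k then y b m else 0)"
      by (rule sum.cong) auto
    then show "(\<Sum>m\<in>nz_squares. y b m * of_bool (m = - k)) = (if - k \<in> nz_squares then y b (- k) else 0)"
      by simp
  qed simp
  also have "\<dots> = (if - k \<in> nz_squares then row_sum y (- k) else 0)"
    by (simp add: row_sum_def)
  finally show ?thesis .
qed

end

section \<open>The size of the kernel\<close>

text \<open>The equations that vanishing harmonic sums impose on the parabola sums for one
  \<open>t\<close>, in solved form; the raw system appears in
  \<open>parabola_kernel_iff\<close>.\<close>

definition parabola_kernel :: "('a::{field,finite} \<Rightarrow> bit) set" where
  "parabola_kernel = {v. (\<forall>k. k \<notin> squares \<longrightarrow> v k = 0) \<and> v 1 = v 0 \<and>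
     (\<forall>k\<in>nz_squares. k - 1 \<in> nz_squares \<longrightarrow> v k = 0) \<and> (\<Sum>k\<in>nz_squares. v k) = 0}"

text \<open>The equations that vanishing harmonic sums impose on the row sums.\<close>

definition row_kernel :: "('a::{field,finite} \<Rightarrow> bit) set" where
  "row_kernel = {v. (\<forall>k. k \<notin> squares \<longrightarrow> v k = 0) \<and>
     (\<forall>k\<in>nz_squares. v 0 + (if - k \<in> nz_squares then v (- k) else 0) = 0) \<and> (\<Sum>k\<in>nz_squares. v k) = 0}"

definition harmonic_kernel :: "('a::{field,finite} \<Rightarrow> 'a \<Rightarrow> bit) set" where
  "harmonic_kernel = {y \<in> vecs. \<forall>c n. harmonic_sum y c n = 0}"

text \<open>Both kinds of coordinates are packed into one function of the same type. Being a
  self-map of a finite set, it is surjective as soon as it is injective, so the coordinates can be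
  prescribed.\<close>

definition transform :: "('a::{field,finite} \<Rightarrow> 'a \<Rightarrow> bit) \<Rightarrow> 'a \<Rightarrow> 'a \<Rightarrow> bit" where
  "transform y t k = parabola_sum y t k + row_sum y k"

lemma sum_in_parabola_kernel:
  assumes "\<And>s. s \<in> A \<Longrightarrow> x s \<in> parabola_kernel"
  shows "(\<lambda>k. \<Sum>s\<in>A. x s k) \<in> parabola_kernel"
proof -
  have "(\<Sum>k\<in>nz_squares. \<Sum>s\<in>A. x s k) = (\<Sum>s\<in>A. \<Sum>k\<in>nz_squares. x s k)"
    by (rule sum.swap)
  then show ?thesis
    using assms by (simp add: parabola_kernel_def)
qed

text \<open>Values at squares \<open>k\<close> with \<open>k - 1\<close> a nonzero square vanish,
  and those at 0 and 1 both equal the sum of the remaining ones, which are free.\<close>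

lemma card_parabola_kernel:
  "card (parabola_kernel :: ('a::{field,finite} \<Rightarrow> bit) set) =
    2 ^ card {k \<in> nz_squares. k \<noteq> 1 \<and> k - 1 \<notin> (nz_squares :: 'a set)}" (is "_ = 2 ^ card ?R")
proof -
  let ?F = "\<lambda>k s. if k = 0 \<or> k = (1::'a) then s else (0::bit)"
  have "v \<in> parabola_kernel \<longleftrightarrow> (\<forall>k. k \<notin> ?R \<longrightarrow> v k = ?F k (\<Sum>i\<in>?R. v i))" for v :: "'a \<Rightarrow> bit"
  proof -
    have split: "(\<Sum>k\<in>nz_squares. v k) = v 1 + (\<Sum>i\<in>?R. v i)"
      if "\<And>k. k \<in> nz_squares \<Longrightarrow> k - 1 \<in> nz_squares \<Longrightarrow> v k = 0"
    proof -
      have "(\<Sum>k\<in>nz_squares. v k) = v 1 + sum v (nz_squares - {1})"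
        by (rule sum.remove) (auto simp: nz_squares_1)
      also have "sum v (nz_squares - {1}) = sum v ?R"
        by (rule sum.mono_neutral_right) (auto simp: that)
      finally show ?thesis .
    qed
    show ?thesis
    proof
      assume v: "v \<in> parabola_kernel"
      then have "v 1 = (\<Sum>i\<in>?R. v i)"
        using split by (auto simp: parabola_kernel_def bit_add_eq_0_iff)
      then show "\<forall>k. k \<notin> ?R \<longrightarrow> v k = ?F k (\<Sum>i\<in>?R. v i)"
        using v by (auto simp: parabola_kernel_def squares_eq)
    next
      assume v: "\<forall>k. k \<notin> ?R \<longrightarrow> v k = ?F k (\<Sum>i\<in>?R. v i)"
      have nz: "v k = 0" if "k \<in> nz_squares" "k - 1 \<in> nz_squares" for k
      proof -
        have "k \<noteq> 0" "k \<noteq> 1" using that nz_squares_nonzero[of k] nz_squares_nonzero[of "k - 1"] by auto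
        then show ?thesis using v that by simp
      qed
      moreover have "v 1 = (\<Sum>i\<in>?R. v i)" "v 0 = (\<Sum>i\<in>?R. v i)"
        using v zero_notin_nz_squares by auto
      moreover have "v k = 0" if "k \<notin> squares" for k
        using v that nz_squares_1 by (auto simp: squares_eq)
      ultimately show "v \<in> parabola_kernel"
        using split[OF nz] by (simp add: parabola_kernel_def bit_add_self)
    qed
  qed
  then have "parabola_kernel = {v. \<forall>k. k \<notin> ?R \<longrightarrow> v k = ?F k (\<Sum>i\<in>?R. v i)}"
    by blast
  then show ?thesis using card_determined_off[of ?R ?F, OF finite] by (simp only:)
qed

text \<open>The first two equations give \<open>v 0 = v 1\<close>. What remains is vanishing at all
  \<open>k / (k - 1)\<close>, and \<open>k \<mapsto> k / (k - 1)\<close> is an involution on the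
  nonzero squares \<open>k\<close> for which \<open>k - 1\<close> is a nonzero square.\<close>

lemma parabola_kernel_iff:
  assumes "\<And>k. k \<notin> squares \<Longrightarrow> v k = 0"
  shows "v \<in> parabola_kernel \<longleftrightarrow> (\<Sum>k\<in>nz_squares. v k) = 0 \<and> v 0 + v 1 + (\<Sum>k\<in>nz_squares. v k) = 0 \<and>
    (\<forall>k\<in>nz_squares. k \<noteq> (1::'a::{field,finite}) \<longrightarrow> v 0 + v 1 + (if k - 1 \<in> nz_squares then v (k / (k - 1)) else 0) = 0)"
    (is "_ \<longleftrightarrow> ?s \<and> ?a \<and> ?b")
proof -
  have inv: "k / (k - 1) \<in> nz_squares" "k / (k - 1) - 1 \<in> nz_squares" "k / (k - 1) \<noteq> 1"
    "k / (k - 1) / (k / (k - 1) - 1) = k"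
    if k: "k \<in> nz_squares" "k - 1 \<in> nz_squares" for k :: 'a
  proof -
    have k1: "k - 1 \<noteq> 0" using nz_squares_nonzero[OF k(2)] .
    then have eq: "k / (k - 1) - 1 = 1 / (k - 1)" by (simp add: field_simps)
    show "k / (k - 1) \<in> nz_squares" using k by (rule nz_squares_divide)
    show *: "k / (k - 1) - 1 \<in> nz_squares" unfolding eq using k(2) nz_squares_1 nz_squares_divide by blast
    then show "k / (k - 1) \<noteq> 1" using nz_squares_nonzero by fastforce
    show "k / (k - 1) / (k / (k - 1) - 1) = k" unfolding eq using k1 by simp
  qed
  show ?thesis
  proof
    assume v: "v \<in> parabola_kernel"
    then have "v (k / (k - 1)) = 0" if "k \<in> nz_squares" "k - 1 \<in> nz_squares" for k
      using inv[OF that] by (simp add: parabola_kernel_def)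
    then show "?s \<and> ?a \<and> ?b"
      using v by (auto simp: parabola_kernel_def bit_add_self)
  next
    assume *: "?s \<and> ?a \<and> ?b"
    then have eq: "v 1 = v 0" by (metis add.right_neutral bit_add_eq_0_iff)
    have "v k = 0" if k: "k \<in> nz_squares" "k - 1 \<in> nz_squares" for k
      using * inv[OF k] eq by (metis bit_add_self add.left_neutral)
    then show "v \<in> parabola_kernel"
      using * eq assms by (simp add: parabola_kernel_def)
  qed
qed

lemma parabola_sum_off_squares:
  assumes "y \<in> vecs" "k \<notin> squares"
  shows "parabola_sum y t k = 0"
  unfolding parabola_sum_def
proof (rule sum.neutral, rule ballI)
  fix c assume "c \<in> UNIV - {t}"
  then have "k = k * (c - t)\<^sup>2 / (c - t)\<^sup>2" by simp
  then have "k * (c - t)\<^sup>2 \<notin> squares" using squares_divide_power2 assms(2) by metis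
  then show "y c (k * (c - t)\<^sup>2) = 0" using assms(1) by (simp add: vecs_def)
qed

lemma row_sum_off_squares: "y \<in> vecs \<Longrightarrow> k \<notin> squares \<Longrightarrow> row_sum y k = 0"
  by (simp add: row_sum_def vecs_def)

context odd_field
begin

text \<open>If -1 is a square, all values at nonzero squares equal \<open>v 0\<close>, and the sum
  condition holds because their number is even: one free bit. Otherwise \<open>v 0 = 0\<close> and
  only the sum condition remains, which fixes the value at 1 by the others.\<close>

lemma card_row_kernel:
  "card (row_kernel :: ('a \<Rightarrow> bit) set) =
    (if (- 1 :: 'a) \<in> nz_squares then 2 else 2 ^ (card (nz_squares :: 'a set) - 1))"
proof (cases "(- 1 :: 'a) \<in> nz_squares")
  case True
  let ?F = "\<lambda>k s. if k \<in> (nz_squares :: 'a set) then s else (0::bit)"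
  have neg: "- k \<in> nz_squares \<longleftrightarrow> k \<in> nz_squares" for k :: 'a
    using nz_squares_mult_iff[OF True, of k] by simp
  have "v \<in> row_kernel \<longleftrightarrow> (\<forall>k. k \<notin> {0} \<longrightarrow> v k = ?F k (\<Sum>i\<in>{0}. v i))" for v :: "'a \<Rightarrow> bit"
  proof
    assume v: "v \<in> row_kernel"
    have "v k = v 0" if "k \<in> nz_squares" for k
    proof -
      have "- k \<in> nz_squares" using that neg by simp
      then have "v 0 + v k = 0" using v that unfolding row_kernel_def by fastforce
      then show ?thesis by (simp add: bit_add_eq_0_iff)
    qed
    moreover have "v k = 0" if "k \<noteq> 0" "k \<notin> nz_squares" for k
      using v that by (simp add: row_kernel_def squares_eq)
    ultimately show "\<forall>k. k \<notin> {0} \<longrightarrow> v k = ?F k (\<Sum>i\<in>{0}. v i)"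
      by simp
  next
    assume v: "\<forall>k. k \<notin> {0} \<longrightarrow> v k = ?F k (\<Sum>i\<in>{0}. v i)"
    then have v0: "v k = v 0" if "k \<in> nz_squares" for k
      using that nz_squares_nonzero[OF that] by simp
    have "(\<Sum>k\<in>nz_squares. v k) = of_nat (card (nz_squares :: 'a set)) * v 0"
      by (simp add: v0)
    then have "(\<Sum>k\<in>nz_squares. v k) = 0"
      using True neg1_square_iff by (simp add: of_nat_bit)
    then show "v \<in> row_kernel"
      using v v0 by (auto simp: row_kernel_def squares_eq neg bit_add_self)
  qed
  then have "row_kernel = {v. \<forall>k. k \<notin> {0::'a} \<longrightarrow> v k = ?F k (\<Sum>i\<in>{0}. v i)}"
    by blast
  then show ?thesis
    using True card_determined_off[of "{0}" ?F] by (simp only: if_True) simp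
next
  case False
  let ?A = "nz_squares - {1} :: 'a set"
  let ?F = "\<lambda>k s. if k = (1::'a) then s else (0::bit)"
  have neg: "- k \<notin> nz_squares" if "k \<in> nz_squares" for k :: 'a
    using nz_squares_mult_iff[OF that, of "- 1"] False by simp
  have split: "(\<Sum>k\<in>nz_squares. v k) = v 1 + (\<Sum>i\<in>?A. v i)" for v :: "'a \<Rightarrow> bit"
    by (rule sum.remove) (auto simp: nz_squares_1)
  have "v \<in> row_kernel \<longleftrightarrow> (\<forall>k. k \<notin> ?A \<longrightarrow> v k = ?F k (\<Sum>i\<in>?A. v i))" for v :: "'a \<Rightarrow> bit"
  proof
    assume v: "v \<in> row_kernel"
    then have "v 1 = (\<Sum>i\<in>?A. v i)"
      using split[of v] by (simp add: row_kernel_def bit_add_eq_0_iff)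
    moreover have "v 0 = 0"
      using v neg nz_squares_1 by (auto simp: row_kernel_def)
    moreover have "v k = 0" if "k \<notin> nz_squares" for k
      using v that \<open>v 0 = 0\<close> by (cases "k = 0") (auto simp: row_kernel_def squares_eq)
    ultimately show "\<forall>k. k \<notin> ?A \<longrightarrow> v k = ?F k (\<Sum>i\<in>?A. v i)"
      by auto
  next
    assume v: "\<forall>k. k \<notin> ?A \<longrightarrow> v k = ?F k (\<Sum>i\<in>?A. v i)"
    then have "v 1 = (\<Sum>i\<in>?A. v i)" "v 0 = 0"
      using zero_notin_nz_squares by auto
    moreover have "v k = 0" if "k \<notin> squares" for k
      using v that nz_squares_1 by (auto simp: squares_eq)
    ultimately show "v \<in> row_kernel"
      using split[of v] neg by (simp add: row_kernel_def bit_add_self)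
  qed
  then have "row_kernel = {v. \<forall>k. k \<notin> ?A \<longrightarrow> v k = ?F k (\<Sum>i\<in>?A. v i)}"
    by blast
  then show ?thesis
    using False card_determined_off[of ?A ?F, OF finite]
    by (simp only: if_False card_Diff_singleton[OF nz_squares_1])
qed

text \<open>By \<open>parabola_inversion\<close>, applied to \<open>harmonic_sum y\<close>, the
  harmonic sums vanish iff all their row and parabola sums do. Squares \<open>k\<close> suffice,
  since dividing a square by a square gives a square.\<close>

lemma harmonic_kernel_iff:
  fixes y :: "'a \<Rightarrow> 'a \<Rightarrow> bit"
  assumes y: "y \<in> vecs"
  shows "y \<in> harmonic_kernel \<longleftrightarrow> row_sum y \<in> row_kernel \<and> (\<forall>t. parabola_sum y t \<in> parabola_kernel)"
proof -
  have "(\<forall>c n. harmonic_sum y c n = 0) \<longleftrightarrow>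
      (\<forall>k\<in>squares. row_sum (harmonic_sum y) k = 0) \<and>
      (\<forall>t. \<forall>k\<in>squares. parabola_sum (harmonic_sum y) t k = 0)" (is "?l \<longleftrightarrow> ?r1 \<and> ?r2")
  proof
    assume ?l
    then show "?r1 \<and> ?r2" by (simp add: row_sum_def parabola_sum_def)
  next
    assume r: "?r1 \<and> ?r2"
    show ?l
    proof (intro allI)
      fix c n
      show "harmonic_sum y c n = 0"
      proof (cases "n \<in> squares")
        case True
        then show ?thesis
          using r parabola_inversion[of "harmonic_sum y" c n] by (simp add: squares_divide_power2)
      next
        case False
        then show ?thesis by (auto simp: harmonic_sum_def squares_eq)
      qed
    qed
  qed
  moreover have "?r1 \<longleftrightarrow> row_sum y \<in> row_kernel"
    using row_sum_off_squares[OF y]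
    by (auto simp: squares_eq row_kernel_def row_sum_harmonic_sum_0 row_sum_harmonic_sum_nz)
  moreover have "(\<forall>k\<in>squares. parabola_sum (harmonic_sum y) t k = 0) \<longleftrightarrow> parabola_sum y t \<in> parabola_kernel" for t
  proof -
    have "(\<forall>k\<in>squares. P k) \<longleftrightarrow> P 0 \<and> P 1 \<and> (\<forall>k\<in>nz_squares. k \<noteq> (1::'a) \<longrightarrow> P k)" for P
      using nz_squares_1 by (auto simp: squares_eq)
    then show ?thesis
      by (simp add: parabola_kernel_iff[OF parabola_sum_off_squares[OF y]] parabola_sum_harmonic_sum_0
          parabola_sum_harmonic_sum_1 parabola_sum_harmonic_sum)
  qed
  ultimately show ?thesis
    using y by (simp add: harmonic_kernel_def)
qed

text \<open>The parabola sums cancel over all \<open>t\<close>, and an odd number of copies of the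
  row sum remains.\<close>

lemma row_sum_transform: "row_sum (transform y) k = row_sum y (k::'a)"
  using odd_card
  by (simp add: row_sum_def[of "transform y"] transform_def sum.distrib sum_parabola_sum_shift of_nat_bit)

lemma bij_betw_transform: "bij_betw transform (vecs :: ('a \<Rightarrow> 'a \<Rightarrow> bit) set) vecs"
proof -
  have "inj (transform :: ('a \<Rightarrow> 'a \<Rightarrow> bit) \<Rightarrow> _)"
  proof (rule injI)
    fix y z :: "'a \<Rightarrow> 'a \<Rightarrow> bit" assume eq: "transform y = transform z"
    then have row: "row_sum y k = row_sum z k" for k
      using row_sum_transform by metis
    then have "parabola_sum y t k = parabola_sum z t k" for t k
      using fun_cong[OF fun_cong[OF eq], of t k] by (simp add: transform_def)
    then show "y = z"
      using parabola_inversion row by (metis (no_types, lifting) ext sum.cong)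
  qed
  moreover have "transform ` (vecs :: ('a \<Rightarrow> 'a \<Rightarrow> bit) set) \<subseteq> vecs"
    by (auto simp: transform_def vecs_def[of] parabola_sum_off_squares row_sum_off_squares)
  moreover have "finite (vecs :: ('a \<Rightarrow> 'a \<Rightarrow> bit) set)" by simp
  ultimately show ?thesis
    using endo_inj_surj by (metis bij_betw_def inj_on_subset subset_UNIV)
qed

text \<open>The row sums and the parabola sums for \<open>t \<noteq> 0\<close> form independent
  coordinates. The parabola sums at \<open>t = 0\<close> are the sums of the others, whence the
  exponent \<open>q - 1\<close>.\<close>

lemma card_harmonic_kernel:
  "card (harmonic_kernel :: ('a \<Rightarrow> 'a \<Rightarrow> bit) set) =
    card (row_kernel :: ('a \<Rightarrow> bit) set) * card (parabola_kernel :: ('a \<Rightarrow> bit) set) ^ (CARD('a) - 1)"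
proof -
  let ?T = "UNIV - {0} :: 'a set"
  let ?f = "\<lambda>y. (row_sum y, restrict (parabola_sum y) ?T)"
  have "bij_betw ?f harmonic_kernel (row_kernel \<times> (?T \<rightarrow>\<^sub>E parabola_kernel))"
  proof (rule bij_betw_imageI)
    have sum0: "parabola_sum y 0 k = (\<Sum>t\<in>?T. parabola_sum y t k)" for y k
      using sum_parabola_sum_shift[of y k] sum.remove[of UNIV 0 "\<lambda>t. parabola_sum y t k"]
      by (simp add: bit_add_eq_0_iff)
    show "inj_on ?f harmonic_kernel"
    proof (rule inj_onI)
      fix y z assume "?f y = ?f z"
      then have row: "row_sum y = row_sum z" and "restrict (parabola_sum y) ?T = restrict (parabola_sum z) ?T"
        by auto
      then have nz: "parabola_sum y t = parabola_sum z t" if "t \<noteq> 0" for t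
        using that by (metis Diff_iff UNIV_I restrict_apply' singletonD)
      then have "parabola_sum y 0 k = parabola_sum z 0 k" for k
        unfolding sum0 by (intro sum.cong) auto
      with nz have "parabola_sum y t k = parabola_sum z t k" for t k
        by (cases "t = 0") auto
      then show "y = z"
        using parabola_inversion row by (metis (no_types, lifting) ext sum.cong)
    qed
    show "?f ` harmonic_kernel = row_kernel \<times> (?T \<rightarrow>\<^sub>E parabola_kernel)"
    proof (intro equalityI subsetI)
      fix p assume "p \<in> ?f ` harmonic_kernel"
      then obtain y where y: "y \<in> harmonic_kernel" "p = ?f y" by auto
      then have "y \<in> vecs" by (simp add: harmonic_kernel_def)
      then show "p \<in> row_kernel \<times> (?T \<rightarrow>\<^sub>E parabola_kernel)"
        using y harmonic_kernel_iff by auto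
    next
      fix p :: "('a \<Rightarrow> bit) \<times> ('a \<Rightarrow> 'a \<Rightarrow> bit)" assume "p \<in> row_kernel \<times> (?T \<rightarrow>\<^sub>E parabola_kernel)"
      then obtain z x where p: "p = (z, x)" "z \<in> row_kernel" "x \<in> ?T \<rightarrow>\<^sub>E parabola_kernel" by auto
      \<comment> \<open>The entry at 0 is forced, because the parabola sums must add up to 0 over
        all \<open>t\<close>.\<close>
      define x' where "x' t k = (if t = 0 then \<Sum>s\<in>?T. x s k else x t k)" for t k
      have zero: "(\<lambda>k. \<Sum>s\<in>?T. x s k) \<in> parabola_kernel"
        using p(3) by (intro sum_in_parabola_kernel) auto
      then have x': "x' t \<in> parabola_kernel" for t
        using p(3) by (cases "t = 0") (auto simp: x'_def[abs_def] PiE_iff)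
      have sumx': "(\<Sum>t\<in>UNIV. x' t k) = 0" for k
      proof -
        have "(\<Sum>t\<in>UNIV. x' t k) = x' 0 k + (\<Sum>t\<in>?T. x' t k)"
          by (rule sum.remove) auto
        also have "(\<Sum>t\<in>?T. x' t k) = (\<Sum>t\<in>?T. x t k)"
          by (rule sum.cong) (auto simp: x'_def)
        also have "\<dots> = x' 0 k"
          by (simp add: x'_def)
        finally show ?thesis by (simp add: bit_add_self)
      qed
      \<comment> \<open>This is the value of \<open>transform y\<close> for any \<open>y\<close>
        with parabola sums \<open>x'\<close> and row sums \<open>z\<close>.\<close>
      define w where "w t k = x' t k + z k" for t k
      have "w \<in> vecs"
        using x' p(2) by (auto simp: vecs_def w_def parabola_kernel_def row_kernel_def)
      then obtain y where y: "y \<in> vecs" "transform y = w"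
        using bij_betw_transform by (metis bij_betw_imp_surj_on imageE)
      have row: "row_sum y = z"
      proof
        fix k
        have "row_sum y k = row_sum w k" using row_sum_transform y(2) by metis
        also have "\<dots> = z k"
          using odd_card by (simp add: row_sum_def w_def sum.distrib sumx' of_nat_bit)
        finally show "row_sum y k = z k" .
      qed
      have par: "parabola_sum y t = x' t" for t
      proof
        fix k show "parabola_sum y t k = x' t k"
          using fun_cong[OF fun_cong[OF y(2)], of t k] row by (simp add: transform_def w_def)
      qed
      have "y \<in> harmonic_kernel"
        using harmonic_kernel_iff[OF y(1)] row par x' p(2) by simp
      moreover have "restrict (parabola_sum y) ?T = x"
      proof (rule extensionalityI)
        show "restrict (parabola_sum y) ?T \<in> extensional ?T" "x \<in> extensional ?T"
          using p(3) by (auto simp: PiE_def)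
        fix t assume "t \<in> ?T"
        then have "x' t = x t" by (intro ext) (simp add: x'_def)
        then show "restrict (parabola_sum y) ?T t = x t" using \<open>t \<in> ?T\<close> par by simp
      qed
      ultimately show "p \<in> ?f ` harmonic_kernel"
        using p(1) row by (intro image_eqI[of _ _ y]) auto
    qed
  qed
  then have "card (harmonic_kernel :: ('a \<Rightarrow> 'a \<Rightarrow> bit) set) =
      card ((row_kernel :: ('a \<Rightarrow> bit) set) \<times> (?T \<rightarrow>\<^sub>E (parabola_kernel :: ('a \<Rightarrow> bit) set)))"
    by (rule bij_betw_same_card)
  then show ?thesis
    by (simp add: card_cartesian_product card_PiE card_Diff_singleton)
qed

end

section \<open>The plane and its conic\<close>

lemma pt_eqD:
  assumes "pt a = pt b"
  obtains k where "a = k *s b"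
proof -
  have "a \<in> vec.span {b}"
    using assms vec.span_base[of a "{a}"] by (simp add: pt_def)
  then show thesis using that by (auto simp: vec.span_singleton)
qed

lemma pt_scale: "k \<noteq> 0 \<Longrightarrow> pt (k *s a) = pt a"
  unfolding pt_def
proof (intro equalityI)
  assume "k \<noteq> 0"
  then have "a = inverse k *s (k *s a)" by simp
  then show "vec.span {a} \<subseteq> vec.span {k *s a}"
    by (metis empty_subsetI insert_subset vec.span_base vec.span_minimal vec.span_scale vec.subspace_span singletonI)
  show "vec.span {k *s a} \<subseteq> vec.span {a}"
    by (simp add: vec.span_base vec.span_minimal vec.span_scale)
qed

lemma line_scale:
  fixes b :: "'a::field ^ 3"
  assumes "k \<noteq> 0"
  shows "line (k *s b) = line b"
proof -
  have "a $ 1 * (k *s b) $ 1 + a $ 2 * (k *s b) $ 2 + a $ 3 * (k *s b) $ 3 =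
      k * (a $ 1 * b $ 1 + a $ 2 * b $ 2 + a $ 3 * b $ 3)" for a :: "'a ^ 3"
    by (simp add: algebra_simps)
  then show ?thesis using assms by (simp add: line_def)
qed

lemma vector_3_eq_iff: "(v :: 'a::field ^ 3) = vector [x, y, z] \<longleftrightarrow> v $ 1 = x \<and> v $ 2 = y \<and> v $ 3 = z"
  by (simp add: vec_eq_iff forall_3)

lemma pt_vector_in_line_iff:
  assumes "x \<noteq> 0 \<or> y \<noteq> 0 \<or> z \<noteq> 0"
  shows "pt (vector [x, y, z]) \<in> line (vector [u, v, w]) \<longleftrightarrow> x * u + y * v + z * w = (0::'a::field)"
proof -
  have "vector [x, y, z] \<noteq> (0 :: 'a ^ 3)"
    using assms by (auto simp: vec_eq_iff forall_3)
  then show ?thesis by (simp add: pt_in_line_iff)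
qed

text \<open>Substituting the conic point with parameter \<open>t\<close> gives
  \<open>(t - c)\<^sup>2 - n\<close>, so for \<open>n = a\<^sup>2 \<noteq> 0\<close> the line joins
  the points with parameters \<open>c + a\<close> and \<open>c - a\<close>. For \<open>n = 0\<close>
  it joins that with parameter \<open>c\<close> to the point at infinity.\<close>

definition secant_line :: "'a::field \<Rightarrow> 'a \<Rightarrow> 'a pg_line" where
  "secant_line c n = (if n = 0 then line (vector [c, - 1, 0]) else line (vector [c\<^sup>2 - n, - (2 * c), 1]))"

text \<open>For a square \<open>n\<close>, the pole of \<open>secant_line c n\<close>: the
  intersection of the tangents at the two conic points on that line.\<close>

definition external_point :: "'a::field \<Rightarrow> 'a \<Rightarrow> 'a pg_point" where
  "external_point c n = (if n = 0 then pt (vector [0, 1, 2 * c]) else pt (vector [1, c, c\<^sup>2 - n]))"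

definition coords :: "bit ^ ('a::{field,finite} pg_point) \<Rightarrow> 'a \<Rightarrow> 'a \<Rightarrow> bit" where
  "coords v c n = (if n \<in> squares then v $ external_point c n else 0)"

lemma conic_point_eq_iff:
  "pt (vector [1, t, t\<^sup>2]) = pt (vector [1, s, s\<^sup>2]) \<longleftrightarrow> t = (s::'a::field)"
proof
  assume "pt (vector [1, t, t\<^sup>2]) = pt (vector [1, s, s\<^sup>2])"
  then obtain k where "vector [1, t, t\<^sup>2] = k *s (vector [1, s, s\<^sup>2] :: 'a ^ 3)" by (rule pt_eqD)
  then show "t = s" by (auto simp: vec_eq_iff forall_3)
qed simp

lemma conic_point_neq_infinity: "pt (vector [1, t, t\<^sup>2]) \<noteq> pt (vector [0, 0, 1 :: 'a::field])"
proof
  assume "pt (vector [1, t, t\<^sup>2]) = pt (vector [0, 0, 1 :: 'a])"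
  then obtain k where "vector [1, t, t\<^sup>2] = k *s (vector [0, 0, 1] :: 'a ^ 3)" by (rule pt_eqD)
  then show False by (auto simp: vec_eq_iff forall_3)
qed

lemma line_inter_conic:
  "line (vector [u, v, w]) \<inter> conic =
    (\<lambda>t. pt (vector [1, t, t\<^sup>2])) ` {t. u + t * v + t\<^sup>2 * w = (0::'a::field)} \<union>
    (if w = 0 then {pt (vector [0, 0, 1])} else {})"
  by (auto simp: conic_def pt_vector_in_line_iff)

lemma card_line_inter_conic:
  "card (line (vector [u, v, w]) \<inter> conic) =
    card {t. u + t * v + t\<^sup>2 * w = (0::'a::{field,finite})} + of_bool (w = 0)"
proof -
  define A where "A = {t. u + t * v + t\<^sup>2 * w = 0}"
  have "card ((\<lambda>t. pt (vector [1, t, t\<^sup>2])) ` A) = card A"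
    by (rule card_image) (auto simp: inj_on_def conic_point_eq_iff)
  moreover have "pt (vector [0, 0, 1]) \<notin> (\<lambda>t. pt (vector [1, t, t\<^sup>2])) ` A"
    using conic_point_neq_infinity by (metis (no_types, lifting) imageE)
  ultimately show ?thesis
    unfolding line_inter_conic A_def[symmetric] by simp
qed

lemma quadratic_shift_iff: "c\<^sup>2 - n - 2 * c * t + t\<^sup>2 = 0 \<longleftrightarrow> (t - c)\<^sup>2 = (n::'a::field)"
proof -
  have "c\<^sup>2 - n - 2 * c * t + t\<^sup>2 = (t - c)\<^sup>2 - n"
    by (simp add: power2_eq_square algebra_simps)
  then show ?thesis by (simp only: right_minus_eq)
qed

lemma card_shifted_sqrt: "card {t. (t - c)\<^sup>2 = (n::'a::{field,finite})} = card {x. x\<^sup>2 = n}"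
  by (rule bij_betw_same_card[of "\<lambda>t. t - c"], rule bij_betwI[where g = "\<lambda>x. x + c"]) auto

lemma line_in_pg_lines: "u \<noteq> 0 \<or> v \<noteq> 0 \<or> w \<noteq> 0 \<Longrightarrow> line (vector [u, v, w]) \<in> (pg_lines :: 'a::{field,finite} pg_line set)"
  unfolding pg_lines_def by (intro CollectI exI[of _ "vector [u, v, w]"]) (auto simp: vec_eq_iff forall_3)

lemma pt_in_pg_points: "u \<noteq> 0 \<or> v \<noteq> 0 \<or> w \<noteq> 0 \<Longrightarrow> pt (vector [u, v, w]) \<in> (pg_points :: 'a::{field,finite} pg_point set)"
  unfolding pg_points_def by (intro CollectI exI[of _ "vector [u, v, w]"]) (auto simp: vec_eq_iff forall_3)

text \<open>The summand 1 stands for \<open>k = 1\<close>, which lies in neither set as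
  \<open>k - 1 = 0\<close>.\<close>

lemma card_nonconsecutive_squares:
  "card {k \<in> nz_squares. k \<noteq> 1 \<and> k - 1 \<notin> (nz_squares :: 'a::{field,finite} set)} + 1 + card {k \<in> nz_squares. k - 1 \<in> (nz_squares :: 'a set)} =
    card (nz_squares :: 'a set)" (is "card ?R + 1 + card ?T = _")
proof -
  have eq: "nz_squares = ?R \<union> insert 1 ?T" using nz_squares_1 by auto
  have "card (nz_squares :: 'a set) = card ?R + card (insert 1 ?T)"
    by (subst eq, rule card_Un_disjoint) auto
  also have "card (insert 1 ?T) = Suc (card ?T)"
    using zero_notin_nz_squares by (intro card_insert_disjoint) auto
  finally show ?thesis by simp
qed

lemma subspace_null_space: "vec.subspace (null_space :: (bit ^ ('a::{field,finite} pg_point)) set)"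
  by (rule vec.subspaceI)
     (auto simp: null_space_def distrib_left sum.distrib mult.left_commute simp flip: sum_distrib_left)

section \<open>Secant lines, tangents and external points in coordinates\<close>

context odd_field
begin

text \<open>The first nonzero coordinate is scaled to 1. The remaining ones are written so that the
  first two cases match \<open>external_point\<close>, with \<open>n\<close> still
  arbitrary.\<close>

lemma pg_point_cases:
  assumes "P \<in> (pg_points :: 'a pg_point set)"
  obtains c n where "P = pt (vector [1, c, c\<^sup>2 - n])"
  | c where "P = pt (vector [0, 1, 2 * c])"
  | "P = pt (vector [0, 0, 1])"
proof -
  obtain a where a: "P = pt a" "a \<noteq> 0"
    using assms by (auto simp: pg_points_def)
  consider "a $ 1 \<noteq> 0" | "a $ 1 = 0" "a $ 2 \<noteq> 0" | "a $ 1 = 0" "a $ 2 = 0" "a $ 3 \<noteq> 0"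
    using a(2) by (auto simp: vec_eq_iff forall_3)
  then show thesis
  proof cases
    case 1
    let ?c = "a $ 2 / a $ 1"
    have "inverse (a $ 1) *s a = vector [1, ?c, ?c\<^sup>2 - (?c\<^sup>2 - a $ 3 / a $ 1)]"
      using 1 by (simp add: vector_3_eq_iff field_simps)
    moreover have "P = pt (inverse (a $ 1) *s a)" using a(1) 1 by (simp add: pt_scale)
    ultimately have "P = pt (vector [1, ?c, ?c\<^sup>2 - (?c\<^sup>2 - a $ 3 / a $ 1)])" by (simp only:)
    then show thesis by (rule that(1))
  next
    case 2
    have "inverse (a $ 2) *s a = vector [0, 1, 2 * (a $ 3 / a $ 2 / 2)]"
      using 2 two by (simp add: vector_3_eq_iff field_simps)
    moreover have "P = pt (inverse (a $ 2) *s a)" using a(1) 2 by (simp add: pt_scale)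
    ultimately have "P = pt (vector [0, 1, 2 * (a $ 3 / a $ 2 / 2)])" by (simp only:)
    then show thesis by (rule that(2))
  next
    case 3
    have "inverse (a $ 3) *s a = vector [0, 0, 1]"
      using 3 by (simp add: vector_3_eq_iff)
    moreover have "P = pt (inverse (a $ 3) *s a)" using a(1) 3 by (simp add: pt_scale)
    ultimately have "P = pt (vector [0, 0, 1])" by (simp only:)
    then show thesis by (rule that(3))
  qed
qed

lemma pg_line_cases:
  assumes "l \<in> (pg_lines :: 'a pg_line set)"
  obtains c n where "l = line (vector [c\<^sup>2 - n, - (2 * c), 1])"
  | c where "l = line (vector [c, - 1, 0])"
  | "l = line (vector [1, 0, 0])"
proof -
  obtain b where b: "l = line b" "b \<noteq> 0"
    using assms by (auto simp: pg_lines_def)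
  consider "b $ 3 \<noteq> 0" | "b $ 3 = 0" "b $ 2 \<noteq> 0" | "b $ 3 = 0" "b $ 2 = 0" "b $ 1 \<noteq> 0"
    using b(2) by (auto simp: vec_eq_iff forall_3)
  then show thesis
  proof cases
    case 1
    let ?c = "- (b $ 2 / b $ 3) / 2"
    have "inverse (b $ 3) *s b = vector [?c\<^sup>2 - (?c\<^sup>2 - b $ 1 / b $ 3), - (2 * ?c), 1]"
      using 1 two by (simp add: vector_3_eq_iff field_simps)
    moreover have "l = line (inverse (b $ 3) *s b)" using b(1) 1 by (simp add: line_scale)
    ultimately have "l = line (vector [?c\<^sup>2 - (?c\<^sup>2 - b $ 1 / b $ 3), - (2 * ?c), 1])" by (simp only:)
    then show thesis by (rule that(1))
  next
    case 2
    have "(- inverse (b $ 2)) *s b = vector [- (b $ 1 / b $ 2), - 1, 0]"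
      using 2 by (simp add: vector_3_eq_iff field_simps)
    moreover have "l = line ((- inverse (b $ 2)) *s b)" using b(1) 2 line_scale[of "- inverse (b $ 2)" b] by simp
    ultimately have "l = line (vector [- (b $ 1 / b $ 2), - 1, 0])" by (simp only:)
    then show thesis by (rule that(2))
  next
    case 3
    have "inverse (b $ 1) *s b = vector [1, 0, 0]"
      using 3 by (simp add: vector_3_eq_iff)
    moreover have "l = line (inverse (b $ 1) *s b)" using b(1) 3 by (simp add: line_scale)
    ultimately have "l = line (vector [1, 0, 0])" by (simp only:)
    then show thesis by (rule that(3))
  qed
qed

lemma card_line_inter_conic_cases:
  "card (line (vector [c\<^sup>2 - n, - (2 * c), 1]) \<inter> conic) = card {x. x\<^sup>2 = (n::'a)}"
  "card (line (vector [c, - 1, 0]) \<inter> conic) = 2"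
  "card (line (vector [1, 0, 0 :: 'a]) \<inter> conic) = 1"
proof -
  have "c\<^sup>2 - n + t * - (2 * c) + t\<^sup>2 * 1 = 0 \<longleftrightarrow> (t - c)\<^sup>2 = n" for t
    using quadratic_shift_iff[of c n t] by (simp add: ac_simps)
  then show "card (line (vector [c\<^sup>2 - n, - (2 * c), 1]) \<inter> conic) = card {x. x\<^sup>2 = n}"
    unfolding card_line_inter_conic by (simp only: card_shifted_sqrt) simp
  have "{t. c + t * - 1 + t\<^sup>2 * 0 = 0} = {c}" by auto
  then show "card (line (vector [c, - 1, 0]) \<inter> conic) = 2"
    unfolding card_line_inter_conic by simp
  show "card (line (vector [1, 0, 0 :: 'a]) \<inter> conic) = 1"
    unfolding card_line_inter_conic by simp
qed

lemma secant_lines_eq: "secant_lines = (\<lambda>(c, n). secant_line c n) ` (UNIV \<times> (squares :: 'a set))"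
proof (intro equalityI subsetI)
  fix l :: "'a pg_line" assume "l \<in> secant_lines"
  then have l: "l \<in> pg_lines" "card (l \<inter> conic) = 2" by (auto simp: secant_lines_def)
  from l(1) show "l \<in> (\<lambda>(c, n). secant_line c n) ` (UNIV \<times> squares)"
  proof (cases rule: pg_line_cases)
    case (1 c n)
    then have "n \<in> nz_squares"
      using l(2) by (auto simp: card_line_inter_conic_cases card_sqrt split: if_splits)
    then show ?thesis using 1
      by (intro image_eqI[of _ _ "(c, n)"]) (auto simp: secant_line_def squares_eq dest: nz_squares_nonzero)
  next
    case (2 c)
    then show ?thesis
      by (intro image_eqI[of _ _ "(c, 0)"]) (auto simp: secant_line_def zero_in_squares)
  next
    case 3
    then show ?thesis using l(2) by (simp add: card_line_inter_conic_cases)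
  qed
next
  fix l :: "'a pg_line" assume "l \<in> (\<lambda>(c, n). secant_line c n) ` (UNIV \<times> squares)"
  then obtain c n where "l = secant_line c n" "n \<in> squares" by auto
  then show "l \<in> secant_lines"
    by (auto simp: secant_lines_def secant_line_def line_in_pg_lines squares_eq
        card_line_inter_conic_cases card_sqrt)
qed

lemma tangent_lines_eq:
  "tangent_lines = insert (line (vector [1, 0, 0])) (range (\<lambda>t::'a. line (vector [t\<^sup>2, - (2 * t), 1])))"
proof (intro equalityI subsetI)
  fix l :: "'a pg_line" assume "l \<in> tangent_lines"
  then have l: "l \<in> pg_lines" "card (l \<inter> conic) = 1" by (auto simp: tangent_lines_def)
  from l(1) show "l \<in> insert (line (vector [1, 0, 0])) (range (\<lambda>t. line (vector [t\<^sup>2, - (2 * t), 1])))"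
  proof (cases rule: pg_line_cases)
    case (1 c n)
    then have "n = 0"
      using l(2) by (auto simp: card_line_inter_conic_cases card_sqrt split: if_splits)
    then show ?thesis using 1 by auto
  next
    case (2 c)
    then show ?thesis using l(2) by (simp add: card_line_inter_conic_cases)
  qed simp
next
  fix l :: "'a pg_line"
  assume "l \<in> insert (line (vector [1, 0, 0])) (range (\<lambda>t. line (vector [t\<^sup>2, - (2 * t), 1])))"
  then show "l \<in> tangent_lines"
    using card_line_inter_conic_cases(1)[where n = 0] card_line_inter_conic_cases(3)
    by (auto simp: tangent_lines_def line_in_pg_lines card_sqrt)
qed

text \<open>Each tangent is determined by its point of contact, so tangents are counted by
  parameters \<open>t\<close>, with one extra for the tangent at infinity.\<close>

lemma card_tangents:
  fixes x y z :: 'a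
  assumes "x \<noteq> 0 \<or> y \<noteq> 0 \<or> z \<noteq> 0"
  shows "card {l \<in> tangent_lines. pt (vector [x, y, z]) \<in> l} =
    card {t. x * t\<^sup>2 + y * - (2 * t) + z = 0} + of_bool (x = 0)"
proof -
  let ?l = "\<lambda>t::'a. line (vector [t\<^sup>2, - (2 * t), 1])" and ?m = "line (vector [1, 0, 0 :: 'a])"
  have inter: "?l t \<inter> conic = {pt (vector [1, t, t\<^sup>2])}" for t
  proof -
    have "t\<^sup>2 + s * - (2 * t) + s\<^sup>2 * 1 = (s - t)\<^sup>2" for s
      by (simp add: power2_eq_square algebra_simps)
    then show ?thesis unfolding line_inter_conic by simp
  qed
  have "inj ?l"
    by (rule injI) (metis inter conic_point_eq_iff singleton_inject)
  moreover have "?m \<noteq> ?l t" for t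
  proof -
    have "pt (vector [0, 0, 1]) \<in> ?m" "pt (vector [0, 0, 1]) \<notin> ?l t"
      by (simp_all add: pt_vector_in_line_iff)
    then show ?thesis by metis
  qed
  moreover have "{l \<in> tangent_lines. pt (vector [x, y, z]) \<in> l} =
      (if x = 0 then {?m} else {}) \<union> ?l ` {t. x * t\<^sup>2 + y * - (2 * t) + z = 0}"
    using assms by (auto simp: tangent_lines_eq pt_vector_in_line_iff)
  ultimately show ?thesis
    by (auto simp: card_image[OF inj_on_subset] card_insert_if)
qed

text \<open>The tangents through \<open>(1, c, c\<^sup>2 - n)\<close> correspond to the square roots
  of \<open>n\<close>; there are two exactly when \<open>n\<close> is a nonzero square.\<close>

lemma external_points_eq: "external_points = (\<lambda>(c, n). external_point c n) ` (UNIV \<times> (squares :: 'a set))"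
proof -
  have c1: "card {l \<in> tangent_lines. pt (vector [1, c, c\<^sup>2 - n]) \<in> l} = card {x. x\<^sup>2 = n}" for c n :: 'a
  proof -
    have "1 * t\<^sup>2 + c * - (2 * t) + (c\<^sup>2 - n) = 0 \<longleftrightarrow> (t - c)\<^sup>2 = n" for t
      using quadratic_shift_iff[of c n t] by (simp add: algebra_simps)
    then show ?thesis by (subst card_tangents) (simp_all only: card_shifted_sqrt, simp_all)
  qed
  have c2: "card {l \<in> tangent_lines. pt (vector [0, 1, 2 * c]) \<in> l} = 2" for c :: 'a
  proof -
    have "{t. 0 * t\<^sup>2 + 1 * - (2 * t) + 2 * c = 0} = {c}"
      using two by auto
    then show ?thesis by (subst card_tangents) (simp_all del: mult_minus_left)
  qed
  have c3: "card {l \<in> tangent_lines. pt (vector [0, 0, 1 :: 'a]) \<in> l} = 1"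
    by (subst card_tangents) simp_all
  show ?thesis
  proof (intro equalityI subsetI)
    fix P :: "'a pg_point" assume "P \<in> external_points"
    then have P: "P \<in> pg_points" "card {l \<in> tangent_lines. P \<in> l} = 2"
      by (auto simp: external_points_def)
    from P(1) show "P \<in> (\<lambda>(c, n). external_point c n) ` (UNIV \<times> squares)"
    proof (cases rule: pg_point_cases)
      case (1 c n)
      then have "n \<in> nz_squares"
        using P(2) by (auto simp: c1 card_sqrt split: if_splits)
      then show ?thesis using 1
        by (intro image_eqI[of _ _ "(c, n)"]) (auto simp: external_point_def squares_eq dest: nz_squares_nonzero)
    next
      case (2 c)
      then show ?thesis
        by (intro image_eqI[of _ _ "(c, 0)"]) (auto simp: external_point_def zero_in_squares)
    next
      case 3
      then show ?thesis using P(2) by (simp add: c3)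
    qed
  next
    fix P :: "'a pg_point" assume "P \<in> (\<lambda>(c, n). external_point c n) ` (UNIV \<times> squares)"
    then obtain c n where "P = external_point c n" "n \<in> squares" by auto
    then show "P \<in> external_points"
      by (auto simp: external_points_def external_point_def pt_in_pg_points squares_eq c1 c2 card_sqrt)
  qed
qed

lemma inj_external_point: "inj (\<lambda>(c, n). external_point c (n::'a))"
proof (rule injI, clarify)
  fix c n d m :: 'a assume eq: "external_point c n = external_point d m"
  consider "n = 0" "m = 0" | "n \<noteq> 0" "m \<noteq> 0" | "n = 0" "m \<noteq> 0" | "n \<noteq> 0" "m = 0" by blast
  then show "c = d \<and> n = m"
  proof cases
    case 1
    then obtain k where "vector [0, 1, 2 * c] = k *s (vector [0, 1, 2 * d] :: 'a ^ 3)"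
      using eq by (auto simp: external_point_def elim: pt_eqD)
    then show ?thesis using 1 two by (auto simp: vec_eq_iff forall_3)
  next
    case 2
    then obtain k where "vector [1, c, c\<^sup>2 - n] = k *s (vector [1, d, d\<^sup>2 - m] :: 'a ^ 3)"
      using eq by (auto simp: external_point_def elim: pt_eqD)
    then show ?thesis by (auto simp: vec_eq_iff forall_3)
  next
    case 3
    then obtain k where "vector [1, d, d\<^sup>2 - m] = k *s (vector [0, 1, 2 * c] :: 'a ^ 3)"
      using eq[symmetric] by (auto simp: external_point_def elim: pt_eqD)
    then show ?thesis by (auto simp: vec_eq_iff forall_3)
  next
    case 4
    then obtain k where "vector [1, c, c\<^sup>2 - n] = k *s (vector [0, 1, 2 * d] :: 'a ^ 3)"
      using eq by (auto simp: external_point_def elim: pt_eqD)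
    then show ?thesis by (auto simp: vec_eq_iff forall_3)
  qed
qed

text \<open>When both codes are finite pairs, \<open>(b - c)\<^sup>2 = m + n\<close> says that the
  quadratics with these pairs as roots are apolar, that is, the pairs separate each other
  harmonically.\<close>

lemma external_point_in_secant_line:
  fixes b c m n :: 'a
  shows "external_point b m \<in> secant_line c n \<longleftrightarrow>
    (if m = 0 then n \<noteq> 0 \<and> b = c else if n = 0 then b = c else (b - c)\<^sup>2 = m + n)"
proof -
  have "1 * (c\<^sup>2 - n) + b * - (2 * c) + (b\<^sup>2 - m) * 1 = 0 \<longleftrightarrow> (b - c)\<^sup>2 = m + n"
    using quadratic_shift_iff[of c "m + n" b] by (simp add: algebra_simps)
  moreover have "0 * (c\<^sup>2 - n) + 1 * - (2 * c) + 2 * b * 1 = 0 \<longleftrightarrow> b = c"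
    using two by auto
  moreover have "1 * c + b * - 1 + (b\<^sup>2 - m) * 0 = 0 \<longleftrightarrow> b = c"
    by auto
  moreover have "0 * c + 1 * - 1 + 2 * b * 0 \<noteq> (0::'a)"
    by simp
  ultimately show ?thesis
    unfolding external_point_def secant_line_def
    by (cases "n = 0"; cases "m = 0") (simp_all only: pt_vector_in_line_iff simp_thms if_True if_False zero_neq_one one_neq_zero)
qed

text \<open>Indexing external points by codes of pairs identifies a row of the incidence matrix with
  a harmonic sum.\<close>

lemma sum_incidence:
  fixes v :: "bit ^ ('a pg_point)"
  assumes "n \<in> squares"
  shows "(\<Sum>P\<in>external_points. incidence (secant_line c n) P * v $ P) = harmonic_sum (coords v) c n"
proof -
  have "(\<Sum>P\<in>external_points. incidence (secant_line c n) P * v $ P) =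
      (\<Sum>(b, m)\<in>UNIV \<times> squares. incidence (secant_line c n) (external_point b m) * v $ external_point b m)"
    unfolding external_points_eq
    by (subst sum.reindex[OF inj_on_subset[OF inj_external_point]]) (auto simp: case_prod_unfold)
  also have "\<dots> = (\<Sum>b\<in>UNIV. \<Sum>m\<in>squares. incidence (secant_line c n) (external_point b m) * coords v b m)"
    unfolding sum.cartesian_product[symmetric] by (intro sum.cong) (simp_all add: coords_def)
  also have "\<dots> = (\<Sum>b\<in>UNIV. incidence (secant_line c n) (external_point b 0) * coords v b 0 +
      (\<Sum>m\<in>nz_squares. incidence (secant_line c n) (external_point b m) * coords v b m))"
    unfolding squares_eq by (simp add: zero_notin_nz_squares)
  also have "\<dots> = harmonic_sum (coords v) c n"
  proof (cases "n = 0")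
    case True
    have "(\<Sum>b\<in>UNIV. incidence (secant_line c n) (external_point b 0) * coords v b 0 +
        (\<Sum>m\<in>nz_squares. incidence (secant_line c n) (external_point b m) * coords v b m)) =
        (\<Sum>b\<in>UNIV. if b = c then \<Sum>m\<in>nz_squares. coords v c m else 0)"
      using True zero_notin_nz_squares
      by (intro sum.cong) (auto simp: incidence_def external_point_in_secant_line intro!: sum.cong sum.neutral)
    then show ?thesis using True by (simp add: harmonic_sum_def)
  next
    case False
    have "(\<Sum>b\<in>UNIV. incidence (secant_line c n) (external_point b 0) * coords v b 0) =
        (\<Sum>b\<in>UNIV. if b = c then coords v c 0 else 0)"
      using False by (intro sum.cong) (auto simp: incidence_def external_point_in_secant_line)
    moreover have "(\<Sum>b\<in>UNIV. \<Sum>m\<in>nz_squares. incidence (secant_line c n) (external_point b m) * coords v b m) =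
        (\<Sum>b\<in>UNIV. \<Sum>m\<in>nz_squares. coords v b m * of_bool ((b - c)\<^sup>2 = m + n))"
      using False by (intro sum.cong refl)
        (auto simp: incidence_def external_point_in_secant_line dest: nz_squares_nonzero)
    ultimately show ?thesis
      using False assms by (simp add: harmonic_sum_def squares_eq sum.distrib)
  qed
  finally show ?thesis .
qed

lemma card_null_space: "card (null_space :: (bit ^ ('a pg_point)) set) = card (harmonic_kernel :: ('a \<Rightarrow> 'a \<Rightarrow> bit) set)"
proof (rule bij_betw_same_card, rule bij_betw_imageI)
  have iff: "v \<in> null_space \<longleftrightarrow> (\<forall>P. P \<notin> external_points \<longrightarrow> v $ P = 0) \<and> coords v \<in> harmonic_kernel"
    for v :: "bit ^ ('a pg_point)"
  proof -
    have "(\<forall>l\<in>secant_lines. (\<Sum>P\<in>external_points. incidence l P * v $ P) = 0) \<longleftrightarrow>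
        (\<forall>c. \<forall>n\<in>squares. harmonic_sum (coords v) c n = 0)"
      by (auto simp: secant_lines_eq sum_incidence)
    also have "\<dots> \<longleftrightarrow> (\<forall>c n. harmonic_sum (coords v) c n = 0)"
      by (auto simp: harmonic_sum_def squares_eq)
    finally show ?thesis
      by (auto simp: null_space_def harmonic_kernel_def vecs_def coords_def)
  qed
  show "inj_on coords (null_space :: (bit ^ ('a pg_point)) set)"
  proof (rule inj_onI)
    fix v w :: "bit ^ ('a pg_point)"
    assume vw: "v \<in> null_space" "w \<in> null_space" "coords v = coords w"
    have "v $ P = w $ P" for P
    proof (cases "P \<in> external_points")
      case True
      then obtain c n where "P = external_point c n" "n \<in> squares"
        by (auto simp: external_points_eq)
      then show ?thesis using fun_cong[OF fun_cong[OF vw(3)], of c n] by (simp add: coords_def)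
    next
      case False
      then show ?thesis using vw iff by simp
    qed
    then show "v = w" by (simp add: vec_eq_iff)
  qed
  show "coords ` (null_space :: (bit ^ ('a pg_point)) set) = harmonic_kernel"
  proof (intro equalityI subsetI)
    fix y assume "y \<in> coords ` (null_space :: (bit ^ ('a pg_point)) set)"
    then show "y \<in> harmonic_kernel" using iff by auto
  next
    fix y :: "'a \<Rightarrow> 'a \<Rightarrow> bit" assume y: "y \<in> harmonic_kernel"
    \<comment> \<open>The values of \<open>y\<close> are carried to the external points along the
      inverse of the injective parametrization and extended by 0.\<close>
    define v :: "bit ^ ('a pg_point)" where
      "v = (\<chi> P. if P \<in> external_points then case_prod y (inv (\<lambda>(c, n). external_point c n) P) else 0)"
    have "v $ external_point c n = y c n" if "n \<in> squares" for c n
      using that inv_f_f[OF inj_external_point, of "(c, n)"] by (auto simp: v_def external_points_eq)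
    then have "coords v = y"
      using y by (auto simp: fun_eq_iff coords_def harmonic_kernel_def vecs_def)
    moreover have "v \<in> null_space"
      unfolding iff using y \<open>coords v = y\<close> by (simp add: v_def)
    ultimately show "y \<in> coords ` (null_space :: (bit ^ ('a pg_point)) set)" by blast
  qed
qed

end

section \<open>The dimension in the two residue classes\<close>

theorem corollary7p3:
  fixes q :: nat
  assumes "q = CARD('a::{field,finite})" and "odd q"
  shows "(q mod 4 = 1 \<longrightarrow>
            real (vec.dim (null_space :: (bit ^ ('a pg_point)) set)) = (real q - 1)\<^sup>2 / 4 + 1) \<and>
         (q mod 4 = 3 \<longrightarrow>
            real (vec.dim (null_space :: (bit ^ ('a pg_point)) set)) = (real q - 1)\<^sup>2 / 4 - 1)"
proof -
  interpret odd_field "TYPE('a)"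
    using assms by unfold_locales simp
  let ?d = "vec.dim (null_space :: (bit ^ ('a pg_point)) set)"
  let ?S = "nz_squares :: 'a set"
  let ?r = "card {k \<in> ?S. k \<noteq> 1 \<and> k - 1 \<notin> ?S}" and ?t = "card {k \<in> ?S. k - 1 \<in> ?S}"
  have bit: "CARD(bit) = 2" by (subst UNIV_bit) simp
  have "2 ^ ?d = card (null_space :: (bit ^ ('a pg_point)) set)"
    using card_subspace[OF subspace_null_space[where 'a = 'a]] bit by simp
  also have "\<dots> = card (row_kernel :: ('a \<Rightarrow> bit) set) * (2 ^ ?r) ^ (q - 1)"
    using card_null_space card_harmonic_kernel card_parabola_kernel[where 'a = 'a] assms(1) by simp
  finally have dim: "2 ^ ?d = card (row_kernel :: ('a \<Rightarrow> bit) set) * 2 ^ (?r * (q - 1))"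
    by (simp add: power_mult)
  have S: "2 * card ?S + 1 = q" using card_nz_squares assms(1) by simp
  have rt: "?r + 1 + ?t = card ?S" by (rule card_nonconsecutive_squares)
  have t: "4 * ?t + 2 + card {x. x\<^sup>2 = (- 1 :: 'a)} + 1 = q"
    using card_consecutive_squares assms(1) by simp
  show ?thesis
  proof (intro conjI impI)
    assume q: "q mod 4 = 1"
    then have "even (card ?S)" using S by presburger
    then have neg: "(- 1 :: 'a) \<in> ?S" using neg1_square_iff by simp
    then have "2 ^ ?d = (2::nat) ^ (1 + ?r * (q - 1))"
      using dim card_row_kernel by simp
    then have "?d = 1 + ?r * (q - 1)" by (simp only: power_inject_exp)
    \<comment> \<open>Here -1 has two square roots, so \<open>q = 4 * ?t + 5\<close>; elimination of
      \<open>?t\<close> and \<open>card ?S\<close> gives \<open>?r\<close>.\<close>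
    moreover have "q = 4 * ?r + 1"
      using S rt t neg card_sqrt[of "- 1"] by simp
    ultimately show "real ?d = (real q - 1)\<^sup>2 / 4 + 1"
      by (simp add: power2_eq_square)
  next
    assume q: "q mod 4 = 3"
    then have "odd (card ?S)" using S by presburger
    then have neg: "(- 1 :: 'a) \<notin> ?S" using neg1_square_iff by simp
    then have "2 ^ ?d = (2::nat) ^ ((card ?S - 1) + ?r * (q - 1))"
      using dim card_row_kernel by (simp add: power_add)
    then have d: "?d = (card ?S - 1) + ?r * (q - 1)" by (simp only: power_inject_exp)
    \<comment> \<open>Now -1 has no square root and \<open>q = 4 * ?t + 3\<close>. The dimension
      becomes \<open>?r * (q + 1)\<close>, that is \<open>(q - 3) * (q + 1) / 4\<close>.\<close>
    have "q = 4 * ?r + 3"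
      using S rt t neg card_sqrt[of "- 1"] by simp
    moreover from this have "card ?S = 2 * ?r + 1" using S by simp
    ultimately show "real ?d = (real q - 1)\<^sup>2 / 4 - 1"
      using d by (simp add: power2_eq_square algebra_simps)
  qed
qed

end
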